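(* For every oriented link diagram $D$, $$2u(D)+sr(D)\leq d(D)+d(-D)+sr(D).$$
   Context: A link diagram $D$ is a diagram (on $\mathbb{S}^2$) of an $r$-component link, $r\ge 1$, with components $D^1,\dots,D^r$. $-D$ is $D$ with the orientations of all components reversed. $sr(D)$ is the number of components $D^i$ of $D$ having at least one self-crossing (a crossing both of whose strands belong to the same component). $u(D)$ is the unlinking number of $D$: the smallest number of crossing changes needed to obtain a diagram of a trivial link from $D$. Warping degree. A base point sequence ${\bf a}=(a_1,\dots,a_r)$ of an oriented link diagram $D$ is an ordered sequence of points, exactly one on each component, none at a crossing point; the order of ${\bf a}$ determines the order of the components, and we write $D_{\bf a}=D^1_{a_1}\cup\dots\cup D^r_{a_r}$. A self-crossing $p$ of $D^i$ is a warping crossing point of $D^i_{a_i}$ if, travelling along the oriented $D^i$ starting from $a_i$, one meets $p$ first at its under-crossing. For $i<j$, a crossing point $p$ of $D^i$ and $D^j$ is a warping crossing point between $D^i_{a_i}$ and $D^j_{a_j}$ if $D^i$ is the under-strand at $p$. $d(D_{\bf a})$ is the total number of warping crossing points of $D_{\bf a}$ (of both kinds), and $d(D)=\min_{\bf a} d(D_{\bf a})$ over all base point sequences ${\bf a}$ (including all orders of the components). *)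

theory Defs
  imports "HOL-Analysis.Analysis"
begin

section \<open>Link diagrams on the 2-sphere\<close>

text \<open>
  The components of a diagram are indexed by \<open>{..<ncomp D}\<close>; \<open>strand D i\<close> is a closed curve
  on the unit sphere, parametrised by the unit circle of the complex plane, and the orientation
  is the counterclockwise one of that circle. A pair \<open>(i, z)\<close> is a place on component \<open>i\<close>.
  \<open>overs D\<close> is the set of those places at which the strand passes over at a crossing.
\<close>

record diagram =
  ncomp :: nat
  strand :: "nat \<Rightarrow> complex \<Rightarrow> real^3"
  overs :: "(nat \<times> complex) set"

definition places :: "nat \<Rightarrow> (nat \<times> complex) set" where
  "places r = {..<r} \<times> sphere 0 1"

definition preim :: "diagram \<Rightarrow> real^3 \<Rightarrow> (nat \<times> complex) set" where
  "preim D p = {(i, z) \<in> places (ncomp D). strand D i z = p}"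

definition crossings :: "diagram \<Rightarrow> (real^3) set" where
  "crossings D = {p. \<exists>x\<in>preim D p. \<exists>y\<in>preim D p. x \<noteq> y}"

definition velocity :: "diagram \<Rightarrow> nat \<times> complex \<Rightarrow> real^3" where
  "velocity D = (\<lambda>(i, z). vector_derivative (\<lambda>t. strand D i (z * cis t)) (at 0))"

text \<open>
  A generic immersion of at least one circle, with over/under information at each crossing.
  Transversality of the two strands at a crossing is linear independence of their velocities.
\<close>

definition link_diagram :: "diagram \<Rightarrow> bool" where
  "link_diagram D \<longleftrightarrow>
     ncomp D \<ge> 1 \<and>
     (\<forall>i<ncomp D. strand D i ` sphere 0 1 \<subseteq> sphere 0 1 \<and>
        (\<lambda>t. strand D i (cis t)) C1_differentiable_on UNIV) \<and>
     (\<forall>x\<in>places (ncomp D). velocity D x \<noteq> 0) \<and>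
     finite (crossings D) \<and>
     (\<forall>p\<in>crossings D. card (preim D p) = 2 \<and>
        (\<forall>x\<in>preim D p. \<forall>y\<in>preim D p. x \<noteq> y \<longrightarrow> \<not> collinear {0, velocity D x, velocity D y}) \<and>
        (\<exists>!x. x \<in> preim D p \<inter> overs D)) \<and>
     overs D \<subseteq> (\<Union>p\<in>crossings D. preim D p)"

definition reverse_diagram :: "diagram \<Rightarrow> diagram" where
  "reverse_diagram D = \<lparr>ncomp = ncomp D, strand = (\<lambda>i z. strand D i (cnj z)),
     overs = {(i, z). (i, cnj z) \<in> overs D}\<rparr>"

definition self_crossings :: "diagram \<Rightarrow> nat \<Rightarrow> (real^3) set" where
  "self_crossings D i = {p \<in> crossings D. \<forall>x\<in>preim D p. fst x = i}"

definition sr :: "diagram \<Rightarrow> nat" where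
  "sr D = card {i. i < ncomp D \<and> self_crossings D i \<noteq> {}}"


section \<open>Links with a given diagram, trivial links\<close>

definition is_link :: "nat \<Rightarrow> (nat \<Rightarrow> complex \<Rightarrow> real^3) \<Rightarrow> bool" where
  "is_link r L \<longleftrightarrow>
     (\<forall>i<r. continuous_on (sphere 0 1) (L i)) \<and> inj_on (\<lambda>(i, z). L i z) (places r)"

definition link_image :: "nat \<Rightarrow> (nat \<Rightarrow> complex \<Rightarrow> real^3) \<Rightarrow> (real^3) set" where
  "link_image r L = (\<Union>i<r. L i ` sphere 0 1)"

text \<open>
  The projection is the radial one from space without the origin to the unit sphere
  (\<open>sgn x = x /\<^sub>R norm x\<close>), seen from outside: the over-strand is the one farther from the origin.
  Continuity of \<open>L\<close> is enough to exclude wild links here, since \<open>L\<close> projects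
  to a generic \<open>C\<^sup>1\<close> immersion.
\<close>

definition has_diagram :: "(nat \<Rightarrow> complex \<Rightarrow> real^3) \<Rightarrow> diagram \<Rightarrow> bool" where
  "has_diagram L D \<longleftrightarrow>
     is_link (ncomp D) L \<and>
     (\<forall>(i, z)\<in>places (ncomp D). L i z \<noteq> 0 \<and> sgn (L i z) = strand D i z) \<and>
     (\<forall>p\<in>crossings D. \<forall>(i, z)\<in>preim D p \<inter> overs D. \<forall>(j, w)\<in>preim D p - overs D.
        norm (L j w) < norm (L i z))"

definition ambient_isotopic :: "'a::topological_space set \<Rightarrow> 'a set \<Rightarrow> bool" where
  "ambient_isotopic A B \<longleftrightarrow>
     (\<exists>f. homotopic_with (homeomorphic_map euclidean euclidean) euclidean euclidean id f \<and>
          f ` A = B)"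

text \<open>Disjoint unit circles in the plane \<open>x\<^sub>3 = 0\<close>, with centres \<open>(3k, 0, 0)\<close>, \<open>k < r\<close>.\<close>

definition standard_unlink :: "nat \<Rightarrow> (real^3) set" where
  "standard_unlink r =
     {vector [3 * real k + Re z, Im z, 0] | k z. k < r \<and> z \<in> sphere 0 1}"

definition trivial_link :: "nat \<Rightarrow> (nat \<Rightarrow> complex \<Rightarrow> real^3) \<Rightarrow> bool" where
  "trivial_link r L \<longleftrightarrow> is_link r L \<and> ambient_isotopic (link_image r L) (standard_unlink r)"

definition trivial_diagram :: "diagram \<Rightarrow> bool" where
  "trivial_diagram D \<longleftrightarrow> (\<exists>L. has_diagram L D \<and> trivial_link (ncomp D) L)"


section \<open>Crossing changes and the unlinking number\<close>

definition change_at :: "real^3 \<Rightarrow> diagram \<Rightarrow> diagram" where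
  "change_at p D = D\<lparr>overs := (overs D - preim D p) \<union> (preim D p - overs D)\<rparr>"

definition crossing_change :: "diagram \<Rightarrow> diagram \<Rightarrow> bool" where
  "crossing_change D E \<longleftrightarrow> (\<exists>p\<in>crossings D. E = change_at p D)"

definition unlinking_number :: "diagram \<Rightarrow> nat" where
  "unlinking_number D = (LEAST n. \<exists>E. (crossing_change ^^ n) D E \<and> trivial_diagram E)"


section \<open>Warping degree\<close>

text \<open>
  A base point is given together with the component it lies on; the order of the list is the
  order of the components.
\<close>

definition base_point_seq :: "diagram \<Rightarrow> (nat \<times> complex) list \<Rightarrow> bool" where
  "base_point_seq D as \<longleftrightarrow>
     distinct (map fst as) \<and> set (map fst as) = {..<ncomp D} \<and>
     (\<forall>(i, a)\<in>set as. a \<in> sphere 0 1 \<and> strand D i a \<notin> crossings D)"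

text \<open>
  Travelling along a component from its base point \<open>a\<close>, the place \<open>z\<close> is met after the
  angle \<open>Arg2pi (z / a)\<close>, which lies in \<open>[0, 2\<pi>)\<close>.
\<close>

definition warping_self :: "diagram \<Rightarrow> nat \<times> complex \<Rightarrow> (real^3) set" where
  "warping_self D = (\<lambda>(i, a). {p \<in> self_crossings D i.
     \<exists>z w. (i, z) \<in> preim D p \<inter> overs D \<and> (i, w) \<in> preim D p - overs D \<and>
           Arg2pi (w / a) < Arg2pi (z / a)})"

definition warping_between :: "diagram \<Rightarrow> nat \<Rightarrow> nat \<Rightarrow> (real^3) set" where
  "warping_between D i j = {p \<in> crossings D.
     \<exists>z w. (i, w) \<in> preim D p - overs D \<and> (j, z) \<in> preim D p \<inter> overs D}"

definition warping_crossings :: "diagram \<Rightarrow> (nat \<times> complex) list \<Rightarrow> (real^3) set" where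
  "warping_crossings D as =
     (\<Union>k<length as. warping_self D (as ! k)) \<union>
     (\<Union>l<length as. \<Union>k<l. warping_between D (fst (as ! k)) (fst (as ! l)))"

definition warping_degree_at :: "diagram \<Rightarrow> (nat \<times> complex) list \<Rightarrow> nat" where
  "warping_degree_at D as = card (warping_crossings D as)"

definition warping_degree :: "diagram \<Rightarrow> nat" where
  "warping_degree D = (LEAST n. \<exists>as. base_point_seq D as \<and> warping_degree_at D as = n)"

end

theory Submission
  imports Defs
begin

text \<open>
  Both warping degrees bound the unlinking number. Changing the crossings that are warping for a
  base point sequence makes the diagram descending: earlier components lie over later ones, and
  each component, followed from its base point, meets every self-crossing first at the over-strand.
  A descending diagram is a diagram of a trivial link, so \<open>u(D) \<le> d(D)\<close>
  (\<open>unlinking_number_le_warping_degree\<close>). Running backwards through the circles turns the links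
  with diagram \<open>D\<close> into those with diagram \<open>-D\<close> and keeps their images, so \<open>u(-D) = u(D)\<close>
  (\<open>unlinking_number_reverse\<close>). Adding \<open>u(D) \<le> d(D)\<close> and \<open>u(-D) \<le> d(-D)\<close> gives the claim.

  The geometric content is that descending diagrams are trivial. A diagram determines its link only
  up to the distances of the points from the origin, and these can be chosen freely as long as the
  over-strands are farther out. Number the components from the innermost to the outermost. The
  \<open>k\<close>-th one is placed in the shell of radii \<open>[d - 1, d + 1]\<close>, where \<open>d = 3 k + 3\<close>: from its base
  point it sinks from the outer to the inner sphere of the shell, and on a crossing-free arc just
  before the base point it climbs back. Every sphere strictly inside the shell then meets the
  component in exactly two points, one on the falling strand \<open>P\<close> and one on the rising
  strand \<open>Q\<close>.

  Both strands are straightened at once by homeomorphisms of space that map every sphere around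
  the origin to itself. Choose a direction \<open>N\<close> that no strand takes. Pushing every sphere away from
  \<open>N\<close> (\<open>ambient_isotopic_push_from_point\<close>) brings all strands into an open half-space. Central
  projection identifies an open hemisphere with the complex plane, where the two strands become
  \<open>z\<^sub>1(r) \<noteq> z\<^sub>2(r)\<close>, and affine maps of the plane come from linear maps of space. An affine map
  depending on the radius \<open>r\<close> sends \<open>z\<^sub>1(r)\<close> and \<open>z\<^sub>2(r)\<close> to \<open>-\<beta>(r)\<close> and \<open>\<beta>(r)\<close>, where \<open>\<beta>\<close> is
  chosen such that the component becomes a round unit circle with centre at distance \<open>d\<close>. Its
  factor is \<open>2 \<beta> / (z\<^sub>2 - z\<^sub>1)\<close>; it extends to the two radii at which the strands meet because
  numerator and denominator vanish there to the same order, which is where the immersion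
  property (nonzero velocity) enters. On a union of intervals this factor has a continuous
  logarithm \<open>\<mu>\<close>, which extends to all radii; multiplying \<open>\<mu>\<close> by \<open>s \<in> [0, 1]\<close>
  contracts the whole construction to the identity and thereby yields an ambient isotopy.
\<close>

section \<open>Ambient isotopies that preserve spheres around the origin\<close>

lemma ambient_isotopicI:
  fixes F :: "real \<Rightarrow> 'a::topological_space \<Rightarrow> 'a"
  assumes "continuous_on ({0..1} \<times> UNIV) (\<lambda>(s, x). F s x)"
    and "\<And>s. s \<in> {0..1} \<Longrightarrow> continuous_on UNIV (G s)"
    and "\<And>s x. s \<in> {0..1} \<Longrightarrow> G s (F s x) = x" "\<And>s x. s \<in> {0..1} \<Longrightarrow> F s (G s x) = x"
    and "\<And>x. F 0 x = x"
  shows "ambient_isotopic S (F 1 ` S)"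
proof -
  have cont_F: "continuous_on UNIV (F s)" if "s \<in> {0..1}" for s
  proof -
    have "continuous_on UNIV (\<lambda>x. case (s, x) of (s, x) \<Rightarrow> F s x)"
      using that by (intro continuous_on_compose2[OF assms(1)] continuous_on_Pair continuous_on_const continuous_on_id) auto
    then show ?thesis by simp
  qed
  have "homeomorphic_map euclidean euclidean (F s)" if "s \<in> {0..1}" for s
    unfolding homeomorphic_map_maps homeomorphic_maps_def
    using that assms(2-4) cont_F by (intro exI[of _ "G s"]) auto
  then have hom: "homeomorphic_map euclidean euclidean (F s)" if "s \<in> {0..1}" for s
    using that by blast
  have "homotopic_with (homeomorphic_map euclidean euclidean) euclidean euclidean id (F 1)"
  proof -
    have "continuous_map (prod_topology (top_of_set {0..1}) euclidean) euclidean (\<lambda>(s, x). F s x)"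
    proof -
      have "prod_topology (top_of_set {0..1::real}) (euclidean :: 'a topology) = top_of_set ({0..1} \<times> UNIV)"
        using prod_topology_subtopology_eu[of "{0..1::real}" "UNIV :: 'a set"] by simp
      then show ?thesis using assms(1) by simp
    qed
    then show ?thesis
      unfolding homotopic_with_def using assms(5) hom
      by (intro exI[of _ "\<lambda>(s, x). F s x"]) auto
  qed
  then show ?thesis
    unfolding ambient_isotopic_def by blast
qed

lemma ambient_isotopic_trans:
  assumes "ambient_isotopic A B" "ambient_isotopic B C"
  shows "ambient_isotopic A C"
proof -
  let ?hom = "homotopic_with (homeomorphic_map euclidean euclidean) euclidean euclidean"
  obtain f g where f: "?hom id f" "f ` A = B" and g: "?hom id g" "g ` B = C"
    using assms unfolding ambient_isotopic_def by blast
  have hf: "homeomorphic_map euclidean euclidean f"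
    using f(1) homotopic_with_imp_property by blast
  have "?hom (id \<circ> f) (g \<circ> f)"
    using hf homeomorphic_imp_continuous_map homeomorphic_map_compose
    by (intro homotopic_with_compose_continuous_map_right[OF g(1)]) blast+
  then have "?hom id (g \<circ> f)"
    using f(1) homotopic_with_trans by fastforce
  moreover have "(g \<circ> f) ` A = C"
    using f g by auto
  ultimately show ?thesis
    unfolding ambient_isotopic_def by blast
qed

text \<open>
  The map \<open>x \<mapsto> \<bar>x\<bar> a(x) / \<bar>a(x)\<bar>\<close> acts on each sphere around the origin by the directions of \<open>a\<close>.
  Preserving norms makes it continuous at the origin, where \<open>a\<close> may vanish.
\<close>

lemma continuous_on_norm_scaleR_sgn:
  fixes a :: "real \<times> 'a::real_normed_vector \<Rightarrow> 'a"
  assumes "continuous_on (S \<times> UNIV) a"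
    and nz: "\<And>s x. s \<in> S \<Longrightarrow> x \<noteq> 0 \<Longrightarrow> a (s, x) \<noteq> 0"
  shows "continuous_on (S \<times> UNIV) (\<lambda>p. norm (snd p) *\<^sub>R sgn (a p))"
  unfolding continuous_on_def
proof
  fix p assume p: "p \<in> S \<times> (UNIV :: 'a set)"
  let ?F = "at p within S \<times> UNIV" and ?f = "\<lambda>p. norm (snd p) *\<^sub>R sgn (a p)"
  have snd: "((\<lambda>p. norm (snd p)) \<longlongrightarrow> norm (snd p)) ?F"
    by (intro tendsto_intros)
  show "(?f \<longlongrightarrow> ?f p) ?F"
  proof (cases "snd p = 0")
    case True
    have le: "\<forall>x. norm (?f x) \<le> norm (snd x)"
      by (simp add: norm_sgn)
    have "((\<lambda>p. norm (snd p)) \<longlongrightarrow> 0) ?F"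
      using snd unfolding True norm_zero .
    from Lim_null_comparison[OF always_eventually[OF le] this] have "(?f \<longlongrightarrow> 0) ?F" .
    then show ?thesis
      using True by simp
  next
    case False
    then show ?thesis
      using assms(1)[unfolded continuous_on_def, rule_format, OF p] p nz[of "fst p" "snd p"]
      by (intro tendsto_scaleR tendsto_sgn snd) (simp_all add: mem_Times_iff)
  qed
qed

lemma ambient_isotopic_sphere_preserving:
  fixes a b :: "real \<Rightarrow> 'a::real_normed_vector \<Rightarrow> 'a"
  assumes cont: "continuous_on ({0..1} \<times> UNIV) (\<lambda>(s, x). a s x)"
      "\<And>s. s \<in> {0..1} \<Longrightarrow> continuous_on UNIV (b s)"
    and nz: "\<And>s x. s \<in> {0..1} \<Longrightarrow> x \<noteq> 0 \<Longrightarrow> a s x \<noteq> 0" "\<And>s x. s \<in> {0..1} \<Longrightarrow> x \<noteq> 0 \<Longrightarrow> b s x \<noteq> 0"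
    and inv: "\<And>s x. s \<in> {0..1} \<Longrightarrow> x \<noteq> 0 \<Longrightarrow> sgn (b s (norm x *\<^sub>R sgn (a s x))) = sgn x"
      "\<And>s x. s \<in> {0..1} \<Longrightarrow> x \<noteq> 0 \<Longrightarrow> sgn (a s (norm x *\<^sub>R sgn (b s x))) = sgn x"
    and id: "\<And>x. a 0 x = x"
  shows "ambient_isotopic S ((\<lambda>x. norm x *\<^sub>R sgn (a 1 x)) ` S)"
proof (rule ambient_isotopicI)
  let ?F = "\<lambda>s x. norm x *\<^sub>R sgn (a s x)" and ?G = "\<lambda>s x. norm x *\<^sub>R sgn (b s x)"
  have norm_sgn: "norm x *\<^sub>R sgn x = x" for x :: 'a
    by (cases "x = 0") (simp_all add: sgn_div_norm)
  show "continuous_on ({0..1} \<times> UNIV) (\<lambda>(s, x). ?F s x)"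
    using continuous_on_norm_scaleR_sgn[OF cont(1)] nz(1) by (simp add: case_prod_unfold)
  show "continuous_on UNIV (?G s)" if s: "s \<in> {0..1}" for s
  proof -
    have "continuous_on ({s} \<times> UNIV) (\<lambda>p. norm (snd p) *\<^sub>R sgn (b s (snd p)))"
      using nz(2)[OF s] by (intro continuous_on_norm_scaleR_sgn continuous_on_compose2[OF cont(2)[OF s]])
        (auto intro!: continuous_intros)
    then have "continuous_on UNIV (\<lambda>x. norm (snd (s, x)) *\<^sub>R sgn (b s (snd (s, x))))"
      by (rule continuous_on_compose2) (auto intro!: continuous_on_Pair continuous_on_const continuous_on_id)
    then show ?thesis by simp
  qed
  fix s :: real and x assume s: "s \<in> {0..1}"
  show "?G s (?F s x) = x"
    using inv(1)[OF s] nz(1)[OF s] by (cases "x = 0") (auto simp: norm_sgn Real_Vector_Spaces.norm_sgn)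
  show "?F s (?G s x) = x"
    using inv(2)[OF s] nz(2)[OF s] by (cases "x = 0") (auto simp: norm_sgn Real_Vector_Spaces.norm_sgn)
next
  fix x show "norm x *\<^sub>R sgn (a 0 x) = x"
    by (cases "x = 0") (simp_all add: id sgn_div_norm)
qed

lemma sgn_scaleR_pos: "c > 0 \<Longrightarrow> sgn (c *\<^sub>R x) = sgn (x :: 'a::real_normed_vector)"
  by (simp add: sgn_scaleR)

text \<open>
  A linear automorphism acts on the sphere of directions, and its inverse acts by the inverse map.
  Hence a family of linear automorphisms that depends on the radius and is joined to the identity
  gives an ambient isotopy: both straightening and recentring of the strands have this form.
\<close>

lemma ambient_isotopic_linear_on_spheres:
  fixes A B :: "real \<Rightarrow> real \<Rightarrow> 'a::euclidean_space \<Rightarrow> 'a"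
  assumes cont: "continuous_on ({0..1} \<times> UNIV) (\<lambda>(s, x). A s (norm x) x)"
      "\<And>s. s \<in> {0..1} \<Longrightarrow> continuous_on UNIV (\<lambda>x. B s (norm x) x)"
    and lin: "\<And>s r. s \<in> {0..1} \<Longrightarrow> linear (A s r)" "\<And>s r. s \<in> {0..1} \<Longrightarrow> linear (B s r)"
    and inv: "\<And>s r x. s \<in> {0..1} \<Longrightarrow> B s r (A s r x) = x" "\<And>s r x. s \<in> {0..1} \<Longrightarrow> A s r (B s r x) = x"
    and id: "\<And>r x. A 0 r x = x"
  shows "ambient_isotopic S ((\<lambda>x. norm x *\<^sub>R sgn (A 1 (norm x) x)) ` S)"
proof (rule ambient_isotopic_sphere_preserving[where b = "\<lambda>s x. B s (norm x) x"])
  fix s :: real and x :: 'a assume s: "s \<in> {0..1}" and x: "x \<noteq> 0"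
  show A0: "A s (norm x) x \<noteq> 0"
    using inv(1)[OF s, of "norm x" x] x linear_0[OF lin(2)[OF s]] by auto
  show B0: "B s (norm x) x \<noteq> 0"
    using inv(2)[OF s, of "norm x" x] x linear_0[OF lin(1)[OF s]] by auto
  have pos: "c *\<^sub>R sgn y = (c / norm y) *\<^sub>R y" for c and y :: 'a
    by (simp add: sgn_div_norm divide_inverse)
  show "sgn (B s (norm (norm x *\<^sub>R sgn (A s (norm x) x))) (norm x *\<^sub>R sgn (A s (norm x) x))) = sgn x"
    using A0 x inv(1)[OF s] by (simp add: norm_sgn pos linear_scale[OF lin(2)[OF s]] sgn_scaleR_pos)
  show "sgn (A s (norm (norm x *\<^sub>R sgn (B s (norm x) x))) (norm x *\<^sub>R sgn (B s (norm x) x))) = sgn x"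
    using B0 x inv(2)[OF s] by (simp add: norm_sgn pos linear_scale[OF lin(1)[OF s]] sgn_scaleR_pos)
qed (use cont id in auto)

text \<open>
  A ray from the point \<open>c N\<close> inside the unit ball leaves the ball only once.
\<close>

lemma unit_vectors_eq_if_parallel_from_inner_point:
  fixes u v N :: "'a::real_inner"
  assumes "norm u = 1" "norm v = 1" "norm N = 1" and c: "c\<^sup>2 < 1"
    and "l > 0" and l: "v - c *\<^sub>R N = l *\<^sub>R (u - c *\<^sub>R N)"
  shows "u = v"
proof -
  define m where "m = u - c *\<^sub>R N"
  have u: "u = m + c *\<^sub>R N" and v: "v = l *\<^sub>R m + c *\<^sub>R N"
    using l by (auto simp: m_def algebra_simps)
  have NN: "N \<bullet> N = 1" using assms by (simp add: norm_eq_1)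
  have "u \<bullet> u = 1" using assms by (simp add: norm_eq_1)
  then have f1: "m \<bullet> m + 2 * c * (m \<bullet> N) + c * c = 1"
    using NN unfolding u by (simp add: inner_add inner_commute algebra_simps)
  have "v \<bullet> v = 1" using assms by (simp add: norm_eq_1)
  then have f2: "l * l * (m \<bullet> m) + 2 * c * l * (m \<bullet> N) + c * c = 1"
    using NN unfolding v by (simp add: inner_add inner_commute algebra_simps)
  have "2 * c * (m \<bullet> N) = 1 - c * c - m \<bullet> m" using f1 by simp
  then have "l * l * (m \<bullet> m) + l * (1 - c * c - m \<bullet> m) = 1 - c * c" using f2 by (metis add.commute add_diff_cancel_left' diff_add_cancel mult.assoc mult.commute)
  then have "(l - 1) * (l * (m \<bullet> m) + (1 - c * c)) = 0" by (simp add: algebra_simps)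
  moreover have "l * (m \<bullet> m) + (1 - c * c) > 0"
    using \<open>l > 0\<close> c by (intro add_nonneg_pos mult_nonneg_nonneg) (auto simp: power2_eq_square)
  ultimately have "l = 1" by simp
  then show ?thesis using u v by simp
qed

text \<open>
  On the unit sphere this is the radial projection seen from the inner point \<open>c N\<close> instead of the
  origin. It moves every unit vector \<open>x\<close> with \<open>N \<bullet> x < c\<close> into the half-space \<open>N \<bullet> y < 0\<close>. The
  isotopy slides the centre of projection from the origin to \<open>c N\<close>.
\<close>

lemma ambient_isotopic_push_from_point:
  fixes N :: "'a::euclidean_space"
  assumes N: "norm N = 1" and c: "0 \<le> c" "c < 1"
  shows "ambient_isotopic S ((\<lambda>x. norm x *\<^sub>R sgn (x - (c * norm x) *\<^sub>R N)) ` S)"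
proof -
  define a where "a s x = x - (s * c * norm x) *\<^sub>R N" for s and x :: 'a
  \<comment> \<open>For a unit vector \<open>y\<close>, \<open>root s y\<close> is the positive \<open>t\<close> with \<open>\<bar>t y + s c N\<bar> = 1\<close>, that is, the
    distance from the centre of projection to the sphere in direction \<open>y\<close>; \<open>b\<close> inverts the projection.
    The powers of \<open>norm y\<close> make the formula homogeneous without a division that is singular at \<open>0\<close>.\<close>
  define root where "root s y = sqrt ((s * c)\<^sup>2 * (y \<bullet> N)\<^sup>2 + (1 - (s * c)\<^sup>2) * (norm y)\<^sup>2) - s * c * (y \<bullet> N)"
    for s and y :: 'a
  define b where "b s y = root s y *\<^sub>R y + (s * c * (norm y)\<^sup>2) *\<^sub>R N" for s and y :: 'a
  have sc: "\<bar>s * c\<bar> < 1" "(s * c)\<^sup>2 < 1" "0 \<le> s * c" if "s \<in> {0..1}" for s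
  proof -
    have "s * c \<le> 1 * c" using that c by (intro mult_right_mono) auto
    then show "\<bar>s * c\<bar> < 1" "0 \<le> s * c" using c that by auto
    then show "(s * c)\<^sup>2 < 1" by (simp add: abs_square_less_1)
  qed
  have root_pos: "root s y > 0" if "s \<in> {0..1}" "y \<noteq> 0" for s y
  proof -
    have "\<bar>s * c * (y \<bullet> N)\<bar> = sqrt ((s * c)\<^sup>2 * (y \<bullet> N)\<^sup>2)"
      by (simp add: real_sqrt_mult abs_mult)
    also have "\<dots> < sqrt ((s * c)\<^sup>2 * (y \<bullet> N)\<^sup>2 + (1 - (s * c)\<^sup>2) * (norm y)\<^sup>2)"
      using sc[OF that(1)] that by simp
    finally show ?thesis by (simp add: root_def)
  qed
  have norm_b: "norm (b s y) = (norm y)\<^sup>2" if s: "s \<in> {0..1}" for s y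
  proof -
    let ?u = "s * c" and ?t = "y \<bullet> N" and ?n = "(norm y)\<^sup>2"
    have "0 \<le> ?u\<^sup>2 * ?t\<^sup>2 + (1 - ?u\<^sup>2) * ?n"
      using sc[OF s] by (intro add_nonneg_nonneg mult_nonneg_nonneg) auto
    then have "(root s y + ?u * ?t)\<^sup>2 = ?u\<^sup>2 * ?t\<^sup>2 + (1 - ?u\<^sup>2) * ?n"
      by (simp add: root_def)
    then have q: "(root s y)\<^sup>2 = - 2 * root s y * ?u * ?t + (1 - ?u\<^sup>2) * ?n"
      by (simp add: power2_eq_square algebra_simps)
    have nn: "?n = y \<bullet> y" by (simp add: power2_norm_eq_inner)
    have NN: "N \<bullet> N = 1" using N by (simp add: norm_eq_1)
    have "(norm (b s y))\<^sup>2 = (root s y)\<^sup>2 * ?n + 2 * root s y * (?u * ?n) * ?t + (?u * ?n)\<^sup>2"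
      unfolding b_def nn power2_norm_eq_inner
      using NN by (simp add: inner_add inner_commute power2_eq_square algebra_simps)
    also have "\<dots> = ?n\<^sup>2"
      unfolding q by (simp add: power2_eq_square algebra_simps)
    finally show ?thesis by (rule power2_eq_imp_eq) simp_all
  qed
  have b_step: "b s y - (s * c * norm (b s y)) *\<^sub>R N = root s y *\<^sub>R y" if "s \<in> {0..1}" for s y
    unfolding norm_b[OF that] by (simp add: b_def)
  have a0: "a s x \<noteq> 0" if s: "s \<in> {0..1}" and "x \<noteq> 0" for s x
  proof
    assume "a s x = 0"
    then have "x = (s * c * norm x) *\<^sub>R N" by (simp add: a_def)
    then have "norm x = \<bar>s * c * norm x\<bar> * norm N" by (metis norm_scaleR)
    then show False using sc[OF s] \<open>x \<noteq> 0\<close> N by (simp add: abs_mult)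
  qed
  have b0: "b s x \<noteq> 0" if "s \<in> {0..1}" "x \<noteq> 0" for s x
    using norm_b[OF that(1), of x] that by auto
  have a_hom: "a s (t *\<^sub>R x) = t *\<^sub>R a s x" if "t \<ge> 0" for s t x
    using that by (simp add: a_def algebra_simps)
  have pos: "t *\<^sub>R sgn y = (t / norm y) *\<^sub>R y" for t and y :: 'a
    by (simp add: sgn_div_norm divide_inverse)
  have norm_scaleR_sgn: "norm y *\<^sub>R sgn y = y" for y :: 'a
    by (cases "y = 0") (simp_all add: sgn_div_norm)
  have ab: "sgn (a s (norm x *\<^sub>R sgn (b s x))) = sgn x" if s: "s \<in> {0..1}" and "x \<noteq> 0" for s x
  proof -
    have "a s (norm x *\<^sub>R sgn (b s x)) = (norm x / norm (b s x)) *\<^sub>R (root s x *\<^sub>R x)"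
      unfolding pos using b_step[OF s, of x] by (simp add: a_hom) (simp add: a_def)
    then show ?thesis
      using root_pos[OF that] b0[OF that] that(2) by (simp add: sgn_scaleR_pos)
  qed
  have inj: "sgn x = sgn y" if s: "s \<in> {0..1}" and "x \<noteq> 0" "y \<noteq> 0" and eq: "sgn (a s x) = sgn (a s y)" for s x y
  proof -
    define u v where "u = sgn x" and "v = sgn y"
    have nu: "norm u = 1" and nv: "norm v = 1" using that by (auto simp: u_def v_def norm_sgn)
    have "sgn (a s u) = sgn (a s v)"
      using eq that unfolding u_def v_def sgn_div_norm[of x] sgn_div_norm[of y]
      by (simp add: a_hom sgn_scaleR_pos)
    moreover have "a s u \<noteq> 0" "a s v \<noteq> 0" using nu nv a0[OF s] by (metis norm_zero zero_neq_one)+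
    moreover define l where "l = norm (a s v) / norm (a s u)"
    ultimately have l: "l > 0" and av: "a s v = l *\<^sub>R a s u"
      unfolding l_def by (simp, metis pos scaleR_one scaleR_scaleR sgn_div_norm norm_scaleR_sgn
          mult.commute times_divide_eq_left)
    have "v - (s * c) *\<^sub>R N = l *\<^sub>R (u - (s * c) *\<^sub>R N)"
      using av nu nv by (simp add: a_def)
    then have "u = v"
      using unit_vectors_eq_if_parallel_from_inner_point nu nv N sc(2)[OF s] l by blast
    then show ?thesis by (simp add: u_def v_def)
  qed
  have ba: "sgn (b s (norm x *\<^sub>R sgn (a s x))) = sgn x" if s: "s \<in> {0..1}" and x: "x \<noteq> 0" for s x
  proof -
    define y where "y = norm x *\<^sub>R sgn (a s x)"
    have y: "y \<noteq> 0" using a0[OF that] x by (simp add: y_def sgn_zero_iff)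
    have "sgn (a s (b s y)) = sgn y"
      using ab[OF s y] y b0[OF s y] unfolding pos by (simp add: a_hom sgn_scaleR_pos)
    also have "\<dots> = sgn (a s x)" using x a0[OF s x] by (simp add: y_def sgn_scaleR_pos) (simp add: sgn_div_norm)
    finally show ?thesis using inj[OF s b0[OF s y] x] by (simp add: y_def)
  qed
  have "ambient_isotopic S ((\<lambda>x. norm x *\<^sub>R sgn (a 1 x)) ` S)"
  proof (rule ambient_isotopic_sphere_preserving[where b = b])
    show "continuous_on ({0..1} \<times> UNIV) (\<lambda>(s, x). a s x)"
      unfolding a_def case_prod_unfold by (intro continuous_intros)
    show "continuous_on UNIV (b s)" for s
      unfolding b_def root_def by (intro continuous_intros)
  qed (use a0 b0 ab ba in \<open>auto simp: a_def\<close>)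
  then show ?thesis by (simp add: a_def)
qed

section \<open>Straightening the two strands of each component\<close>

text \<open>
  The straightening maps are found separately in each shell; this glues them along the radius.
\<close>

lemma continuous_extension_from_disjoint_closed:
  fixes f :: "nat \<Rightarrow> real \<Rightarrow> 'a::euclidean_space"
  assumes "\<And>k. k < n \<Longrightarrow> closed (I k)" "\<And>k. k < n \<Longrightarrow> continuous_on (I k) (f k)"
    and "\<And>j k. j < k \<Longrightarrow> k < n \<Longrightarrow> I j \<inter> I k = {}"
  shows "\<exists>F. continuous_on UNIV F \<and> (\<forall>k<n. \<forall>r\<in>I k. F r = f k r)"
  using assms
proof (induction n)
  case 0
  show ?case by (auto intro: exI[of _ "\<lambda>_. 0"])
next
  case (Suc n)
  then obtain F where F: "continuous_on UNIV F" "\<And>k r. k < n \<Longrightarrow> r \<in> I k \<Longrightarrow> F r = f k r"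
    by auto
  let ?U = "\<Union>k<n. I k" and ?G = "\<lambda>r. if r \<in> I n then f n r else F r"
  have disj: "?U \<inter> I n = {}"
    using Suc.prems(3)[of _ n] by fastforce
  have "continuous_on (I n \<union> ?U) ?G"
    using Suc.prems(1,2) disj
    by (intro continuous_on_cases continuous_on_subset[OF F(1)] closed_UN) auto
  then obtain g where g: "continuous_on UNIV g" "\<And>r. r \<in> I n \<union> ?U \<Longrightarrow> g r = ?G r"
    by (rule Tietze_unbounded[where U = UNIV]) (use Suc.prems(1) in \<open>auto intro!: closed_Un closed_UN\<close>)
  have "g r = f k r" if "k < Suc n" "r \<in> I k" for k r
  proof (cases "k = n")
    case True
    then show ?thesis using g(2)[of r] that by auto
  next
    case False
    then have "k < n" using that by simp
    moreover from this have "r \<notin> I n" using that disj by blast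
    ultimately show ?thesis using g(2)[of r] that F(2) by auto
  qed
  then show ?case using g(1) by blast
qed

lemma vector_3_eq_axis: "(vector [a, b, c] :: real^3) = a *\<^sub>R axis 1 1 + b *\<^sub>R axis 2 1 + c *\<^sub>R axis 3 1"
  by (simp add: vec_eq_iff forall_3 axis_def)

text \<open>
  A vector \<open>x\<close> is described by its height \<open>- (N \<bullet> x)\<close> over the plane orthogonal to \<open>N\<close> and by this
  complex number. When \<open>N $ 1 < 0\<close> these are linear coordinates of space
  (\<open>eq_0_if_coords_0\<close>), and \<open>plane_coord x / - (N \<bullet> x)\<close> is the central projection of the half-space
  of positive height to the complex plane.
\<close>

definition plane_coord :: "real^3 \<Rightarrow> complex" where
  "plane_coord x = complex_of_real (x $ 2) + \<i> * complex_of_real (x $ 3)"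

lemma plane_coord_add: "plane_coord (x + y) = plane_coord x + plane_coord y"
  and plane_coord_diff: "plane_coord (x - y) = plane_coord x - plane_coord y"
  and plane_coord_scaleR: "plane_coord (r *\<^sub>R x) = complex_of_real r * plane_coord x"
  by (simp_all add: plane_coord_def algebra_simps)

lemma continuous_on_plane_coord [continuous_intros]:
  "continuous_on S f \<Longrightarrow> continuous_on S (\<lambda>x. plane_coord (f x))"
  unfolding plane_coord_def by (intro continuous_intros)

lemma eq_0_if_coords_0:
  fixes N x :: "real^3"
  assumes "N $ 1 < 0" "N \<bullet> x = 0" "plane_coord x = 0"
  shows "x = 0"
proof -
  have "x $ 2 = 0" "x $ 3 = 0"
    using assms(3) by (auto simp: plane_coord_def complex_eq_iff)
  moreover from this have "x $ 1 = 0"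
    using assms by (simp add: inner_vec_def sum_3)
  ultimately show ?thesis by (simp add: vec_eq_iff forall_3)
qed

text \<open>
  In central projection, \<open>A r\<close> is the affine map \<open>z \<mapsto> exp (\<mu> r) z - q r\<close>, followed by turning the
  height into the first coordinate. The isotopy scales \<open>\<mu>\<close> and \<open>q\<close> and simultaneously tilts the
  direction in which heights are measured from the first axis to \<open>- N\<close>; the latter stays
  invertible because \<open>- N\<close> has a positive first coordinate.
\<close>

lemma ambient_isotopic_affine_on_central_planes:
  fixes N :: "real^3" and \<mu> q :: "real \<Rightarrow> complex"
  assumes N: "N $ 1 < 0" and cont: "continuous_on UNIV \<mu>" "continuous_on UNIV q"
  defines "A \<equiv> \<lambda>r x. let Z = exp (\<mu> r) * plane_coord x + q r * of_real (N \<bullet> x)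
                     in vector [- (N \<bullet> x), Re Z, Im Z] :: real^3"
  shows "ambient_isotopic S ((\<lambda>x. norm x *\<^sub>R sgn (A (norm x) x)) ` S)"
proof -
  \<comment> \<open>\<open>h s\<close> is the tilted height and \<open>Z s r\<close> the affine image; \<open>Y\<close> recovers the old plane coordinate
    from the new vector, after which \<open>b\<close> solves the height equation for the first coordinate.\<close>
  define h where "h s x = (1 - s) * x $ 1 - s * (N \<bullet> x)" for s and x :: "real^3"
  define Z where "Z s r x = exp (of_real s * \<mu> r) * plane_coord x - of_real s * q r * of_real (h s x)"
    for s r and x :: "real^3"
  define a where "a s r x = (vector [h s x, Re (Z s r x), Im (Z s r x)] :: real^3)" for s r x
  define Y where "Y s r y = exp (- of_real s * \<mu> r) * (plane_coord y + of_real s * q r * of_real (y $ 1))"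
    for s r and y :: "real^3"
  define b where "b s r y = (vector [(y $ 1 + s * (N $ 2 * Re (Y s r y) + N $ 3 * Im (Y s r y))) / ((1 - s) - s * N $ 1),
     Re (Y s r y), Im (Y s r y)] :: real^3)" for s r y
  have den: "(1 - s) - s * N $ 1 \<noteq> 0" if "s \<in> {0..1}" for s
  proof (cases "s = 1")
    case True then show ?thesis using N by simp
  next
    case False
    have "s * N $ 1 \<le> 0" using that N by (simp add: mult_nonneg_nonpos)
    then show ?thesis using that False by auto
  qed
  have h_add: "h s (x + y) = h s x + h s y" and h_scale: "h s (t *\<^sub>R x) = t * h s x" for s t x y
    by (simp_all add: h_def inner_add_right algebra_simps)
  have Z_add: "Z s r (x + y) = Z s r x + Z s r y" and Z_scale: "Z s r (t *\<^sub>R x) = of_real t * Z s r x" for s r t x y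
    by (simp_all add: Z_def plane_coord_add plane_coord_scaleR h_add h_scale algebra_simps)
  have Y_add: "Y s r (x + y) = Y s r x + Y s r y" and Y_scale: "Y s r (t *\<^sub>R x) = of_real t * Y s r x" for s r t x y
    by (simp_all add: Y_def plane_coord_add plane_coord_scaleR algebra_simps)
  have N_inner: "N \<bullet> x = N $ 1 * x $ 1 + N $ 2 * x $ 2 + N $ 3 * x $ 3" for x
    by (simp add: inner_vec_def sum_3)
  have exp_inv: "exp (- of_real s * \<mu> r) * exp (of_real s * \<mu> r) = 1" for s :: real and r
    by (simp flip: exp_add)
  have Y_a: "Y s r (a s r x) = plane_coord x" for s r x
  proof -
    have "plane_coord (a s r x) = Z s r x"
      by (simp add: plane_coord_def a_def complex_eq_iff)
    then show ?thesis
      using exp_inv[of s r] by (simp add: Y_def a_def Z_def mult.assoc[symmetric])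
  qed
  have ba: "b s r (a s r x) = x" if "s \<in> {0..1}" for s r x
    using den[OF that] unfolding b_def Y_a
    by (simp add: vec_eq_iff forall_3 a_def h_def N_inner plane_coord_def field_simps)
  have pb: "plane_coord (b s r y) = Y s r y" for s r y
    by (simp add: plane_coord_def b_def complex_eq_iff)
  have h_b: "h s (b s r y) = y $ 1" if "s \<in> {0..1}" for s r y
  proof -
    define X where "X = b s r y $ 1"
    have "X * ((1 - s) - s * N $ 1) = y $ 1 + s * (N $ 2 * Re (Y s r y) + N $ 3 * Im (Y s r y))"
      using den[OF that] by (simp add: X_def b_def)
    then show ?thesis
      unfolding h_def N_inner X_def[symmetric] by (simp add: b_def algebra_simps)
  qed
  have Z_b: "Z s r (b s r y) = plane_coord y" if "s \<in> {0..1}" for s r y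
    unfolding Z_def pb h_b[OF that] using exp_inv[of s r]
    by (simp add: Y_def mult.assoc[symmetric] mult.commute[of "exp (of_real s * \<mu> r)"])
  have ab: "a s r (b s r y) = y" if "s \<in> {0..1}" for s r y
    unfolding a_def h_b[OF that] Z_b[OF that] by (simp add: vec_eq_iff forall_3 plane_coord_def)
  have comp: "continuous_on T (\<lambda>p. \<mu> (g p))" "continuous_on T (\<lambda>p. q (g p))" if "continuous_on T g"
    for T and g :: "'b::topological_space \<Rightarrow> real"
    using that cont by (auto intro: continuous_on_compose2[where t = UNIV])
  have "ambient_isotopic S ((\<lambda>x. norm x *\<^sub>R sgn (a 1 (norm x) x)) ` S)"
  proof (rule ambient_isotopic_linear_on_spheres[where B = b])
    show "continuous_on ({0..1} \<times> UNIV) (\<lambda>(s, x). a s (norm x) x)"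
      unfolding a_def h_def Z_def vector_3_eq_axis case_prod_unfold
      by (intro continuous_intros comp)
    show "continuous_on UNIV (\<lambda>x. b s (norm x) x)" if "s \<in> {0..1}" for s
      unfolding b_def Y_def vector_3_eq_axis
      by (intro continuous_intros comp ballI den[OF that])
    show "linear (a s r)" for s r
      by (rule linearI) (simp_all add: a_def h_add h_scale Z_add Z_scale vec_eq_iff forall_3)
    show "linear (b s r)" if "s \<in> {0..1}" for s r
      by (rule linearI)
        (simp_all add: b_def Y_add Y_scale vec_eq_iff forall_3 add_divide_distrib[symmetric] algebra_simps)
    show "a 0 r x = x" for r x
      by (simp add: a_def h_def Z_def vec_eq_iff forall_3 plane_coord_def)
  qed (use ab ba in auto)
  moreover have "a 1 r x = A r x" for r x
    by (simp add: a_def A_def h_def Z_def Let_def)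
  ultimately show ?thesis by simp
qed

text \<open>
  With \<open>z\<^sub>1\<close>, \<open>z\<^sub>2\<close> the central projections of the pushed strands, the equations say
  \<open>exp (\<mu> t) z\<^sub>1 - q t = - \<beta>\<close> and \<open>exp (\<mu> t) z\<^sub>2 - q t = \<beta>\<close> for \<open>\<beta> = sin t / (d + cos t)\<close>, the
  slope of the unit circle with centre \<open>d\<close> seen from the origin. They force
  \<open>exp (\<mu> t) = 2 \<beta> / (z\<^sub>2 - z\<^sub>1)\<close>. The hypothesis \<open>Q - P = sin t W\<close> with \<open>W \<noteq> 0\<close> lets the factor
  \<open>sin t\<close> cancel, so that this quotient is continuous and nonzero up to the ends of the interval.
\<close>

lemma two_strands_affine_normal_form:
  fixes P Q W :: "real \<Rightarrow> real^3" and N :: "real^3"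
  assumes cont: "continuous_on {0..pi} P" "continuous_on {0..pi} Q" "continuous_on {0..pi} W"
    and unit: "\<And>t. t \<in> {0..pi} \<Longrightarrow> norm (P t) = 1" "\<And>t. t \<in> {0..pi} \<Longrightarrow> norm (Q t) = 1"
    and W: "\<And>t. t \<in> {0..pi} \<Longrightarrow> Q t - P t = sin t *\<^sub>R W t" "\<And>t. t \<in> {0..pi} \<Longrightarrow> W t \<noteq> 0"
    and ends: "W 0 \<bullet> P 0 = 0" "W pi \<bullet> P pi = 0"
    and N: "norm N = 1" "N $ 1 < 0" and c: "0 < c" "c < 1"
    and less_c: "\<And>t. t \<in> {0..pi} \<Longrightarrow> N \<bullet> P t < c" "\<And>t. t \<in> {0..pi} \<Longrightarrow> N \<bullet> Q t < c"
    and d: "d > 1"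
  obtains \<mu> q where "continuous_on {0..pi} \<mu>" "continuous_on {0..pi} q"
    "\<And>t. t \<in> {0..pi} \<Longrightarrow> exp (\<mu> t) * plane_coord (P t - c *\<^sub>R N) + q t * of_real (N \<bullet> (P t - c *\<^sub>R N))
        = of_real (N \<bullet> (P t - c *\<^sub>R N) * (sin t / (d + cos t)))"
    "\<And>t. t \<in> {0..pi} \<Longrightarrow> exp (\<mu> t) * plane_coord (Q t - c *\<^sub>R N) + q t * of_real (N \<bullet> (Q t - c *\<^sub>R N))
        = - of_real (N \<bullet> (Q t - c *\<^sub>R N) * (sin t / (d + cos t)))"
proof -
  define p where "p t = P t - c *\<^sub>R N" for t
  define p' where "p' t = Q t - c *\<^sub>R N" for t
  define h where "h x = - (N \<bullet> x)" for x :: "real^3"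
  define b where "b t = sin t / (d + cos t)" for t :: real
  have NN: "N \<bullet> N = 1" using N by (simp add: norm_eq_1)
  have hp: "h (p t) > 0" "h (p' t) > 0" if "t \<in> {0..pi}" for t
    using less_c[OF that] NN by (auto simp: h_def p_def p'_def inner_diff_right)
  have p': "p' t = p t + sin t *\<^sub>R W t" if "t \<in> {0..pi}" for t
    using W(1)[OF that] by (simp add: p_def p'_def algebra_simps)
  have h_lin: "h (x + y) = h x + h y" "h (x - y) = h x - h y" "h (r *\<^sub>R x) = r * h x" for x y r
    by (simp_all add: h_def inner_add_right inner_diff_right)
  have dcos: "d + cos t > 0" for t using d cos_ge_minus_one[of t] by linarith
  \<comment> \<open>\<open>z\<^sub>2 - z\<^sub>1\<close> equals \<open>sin t D t\<close> divided by the product of the two heights. If \<open>D t\<close> vanished,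
    \<open>W t\<close> would be parallel to \<open>p t\<close>. Inside the interval both strands would then lie on one ray from
    \<open>c N\<close>, hence coincide; at the ends \<open>W t\<close> is tangent to the sphere and \<open>p t\<close> is not.\<close>
  define D where "D t = plane_coord (W t) * of_real (h (p t)) - plane_coord (p t) * of_real (h (W t))" for t
  have D_nz: "D t \<noteq> 0" if t: "t \<in> {0..pi}" for t
  proof
    assume D0: "D t = 0"
    define l where "l = h (W t) / h (p t)"
    have "plane_coord (W t - l *\<^sub>R p t) = 0"
      using D0 hp(1)[OF t] by (simp add: D_def l_def plane_coord_diff plane_coord_scaleR field_simps)
    moreover have "N \<bullet> (W t - l *\<^sub>R p t) = 0"
      using hp(1)[OF t] by (simp add: l_def h_def inner_diff_right)
    ultimately have Wl: "W t = l *\<^sub>R p t"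
      using eq_0_if_coords_0[OF N(2)] by fastforce
    show False
    proof (cases "t = 0 \<or> t = pi")
      case True
      have "c * (N \<bullet> P t) < 1"
      proof -
        have "c * (N \<bullet> P t) \<le> c * c" using less_c(1)[OF t] c by simp
        also have "\<dots> < 1" using c by (metis mult_less_cancel_left_pos mult.right_neutral less_trans)
        finally show ?thesis .
      qed
      moreover have "P t \<bullet> P t = 1" using unit(1)[OF t] by (simp add: norm_eq_1)
      ultimately have "p t \<bullet> P t > 0" by (simp add: p_def inner_diff_left)
      moreover have "W t \<bullet> P t = 0" using ends True by auto
      ultimately have "l = 0" using Wl by auto
      then show False using Wl W(2)[OF t] by simp
    next
      case False
      then have s: "sin t > 0" using t by (intro sin_gt_zero) auto
      have p'l: "p' t = (1 + sin t * l) *\<^sub>R p t"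
        using p'[OF t] Wl by (simp add: algebra_simps)
      have "h (p' t) = (1 + sin t * l) * h (p t)" by (simp add: p'l h_lin)
      then have "1 + sin t * l > 0" using hp[OF t] by (metis zero_less_mult_pos2)
      moreover have "c\<^sup>2 < 1" using c by (simp add: power2_eq_square) (metis mult_less_cancel_left_pos mult.right_neutral less_trans)
      ultimately have "P t = Q t"
        using p'l unit[OF t] N(1) unit_vectors_eq_if_parallel_from_inner_point[of "P t" "Q t" N c "1 + sin t * l"]
        unfolding p_def p'_def by blast
      then show False using W[OF t] s by simp
    qed
  qed
  define M where "M t = 2 * of_real (h (p t)) * of_real (h (p' t)) / (of_real (d + cos t) * D t)" for t
  have cont_p: "continuous_on {0..pi} p" "continuous_on {0..pi} p'"
    unfolding p_def p'_def by (intro continuous_intros cont)+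
  have cont_h: "continuous_on {0..pi} (\<lambda>t. h (f t))" if "continuous_on {0..pi} f" for f
    unfolding h_def by (intro continuous_intros that)
  have cont_D: "continuous_on {0..pi} D"
    unfolding D_def by (intro continuous_intros cont_p cont_h cont)
  have den_nz: "complex_of_real (d + cos t) * D t \<noteq> 0" if "t \<in> {0..pi}" for t
    using D_nz[OF that] dcos[of t] by (simp del: of_real_add)
  have cont_M: "continuous_on {0..pi} M"
    unfolding M_def using den_nz by (intro continuous_intros cont_D cont_p cont_h ballI)
  have M_nz: "M t \<noteq> 0" if "t \<in> {0..pi}" for t
    using that D_nz[OF that] hp[OF that] dcos[of t] unfolding M_def
    by (simp del: of_real_add)
  obtain \<mu> where \<mu>: "continuous_on {0..pi} \<mu>" "\<And>t. t \<in> {0..pi} \<Longrightarrow> M t = exp (\<mu> t)"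
    using continuous_logarithm_on_contractible[OF cont_M] M_nz convex_imp_contractible[of "{0..pi}"]
    by (metis convex_real_interval(5))
  define q where "q t = M t * plane_coord (p t) / of_real (h (p t)) + of_real (b t)" for t
  have cont_q: "continuous_on {0..pi} q"
    unfolding q_def b_def using hp(1) dcos
    by (intro continuous_intros cont_p cont_h cont_M ballI) (simp_all add: less_imp_neq[symmetric])
  have eq1: "M t * plane_coord (p t) - q t * of_real (h (p t)) = - of_real (h (p t) * b t)" if t: "t \<in> {0..pi}" for t
    using hp[OF t] by (simp add: q_def field_simps)
  have eq2: "M t * plane_coord (p' t) - q t * of_real (h (p' t)) = of_real (h (p' t) * b t)" if t: "t \<in> {0..pi}" for t
  proof -
    have "plane_coord (p' t) * of_real (h (p t)) - plane_coord (p t) * of_real (h (p' t)) = of_real (sin t) * D t"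
      by (simp add: p'[OF t] D_def plane_coord_add plane_coord_scaleR h_lin algebra_simps)
    moreover have "M t * D t = 2 * of_real (h (p t)) * of_real (h (p' t)) / of_real (d + cos t)"
      using D_nz[OF t] dcos[of t] by (simp add: M_def del: of_real_add)
    ultimately have "M t * (plane_coord (p' t) * of_real (h (p t)) - plane_coord (p t) * of_real (h (p' t)))
       = of_real (sin t) * (2 * of_real (h (p t)) * of_real (h (p' t)) / of_real (d + cos t))"
      by (metis mult.left_commute)
    also have "\<dots> = 2 * of_real (h (p t)) * of_real (h (p' t)) * of_real (b t)"
      by (simp add: b_def)
    finally have "of_real (h (p t)) * (M t * plane_coord (p' t)) =
       of_real (h (p' t)) * (M t * plane_coord (p t)) + 2 * of_real (h (p t)) * of_real (h (p' t)) * of_real (b t)"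
      by (simp add: algebra_simps)
    also have "M t * plane_coord (p t) = q t * of_real (h (p t)) - of_real (h (p t) * b t)"
      using eq1[OF t] by (simp add: algebra_simps)
    finally have "of_real (h (p t)) * (M t * plane_coord (p' t) - q t * of_real (h (p' t))) =
        of_real (h (p t)) * of_real (h (p' t) * b t)"
      by (simp add: algebra_simps)
    then show ?thesis using hp[OF t] by simp
  qed
  show ?thesis
  proof (rule that[OF \<mu>(1) cont_q])
    fix t :: real assume t: "t \<in> {0..pi}"
    show "exp (\<mu> t) * plane_coord (P t - c *\<^sub>R N) + q t * of_real (N \<bullet> (P t - c *\<^sub>R N))
        = of_real (N \<bullet> (P t - c *\<^sub>R N) * (sin t / (d + cos t)))"
      using eq1[OF t] \<mu>(2)[OF t] by (simp add: p_def h_def b_def)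
    show "exp (\<mu> t) * plane_coord (Q t - c *\<^sub>R N) + q t * of_real (N \<bullet> (Q t - c *\<^sub>R N))
        = - of_real (N \<bullet> (Q t - c *\<^sub>R N) * (sin t / (d + cos t)))"
      using eq2[OF t] \<mu>(2)[OF t] by (simp add: p'_def h_def b_def)
  qed
qed

text \<open>
  The distance from the origin to the point at angle \<open>t\<close> of a unit circle whose centre is at
  distance \<open>d\<close>. As a function on \<open>[0, \<pi>]\<close> it parametrises the radii of one shell, and
  \<open>shell_angle\<close> is its inverse.
\<close>

definition shell_radius :: "real \<Rightarrow> real \<Rightarrow> real" where
  "shell_radius d t = sqrt (d\<^sup>2 + 1 + 2 * d * cos t)"

lemma shell_radius_bounds:
  assumes "d > 1"
  shows "d - 1 \<le> shell_radius d t" "shell_radius d t \<le> d + 1" "shell_radius d t > 0"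
proof -
  have "- (2 * d) \<le> 2 * d * cos t"
    using mult_left_mono[OF cos_ge_minus_one[of t], of "2 * d"] assms by simp
  then show lower: "d - 1 \<le> shell_radius d t"
    unfolding shell_radius_def by (intro real_le_rsqrt) (simp add: power2_eq_square algebra_simps)
  have "2 * d * cos t \<le> 2 * d"
    using mult_left_mono[OF cos_le_one[of t], of "2 * d"] assms by simp
  then show "shell_radius d t \<le> d + 1"
    unfolding shell_radius_def using assms by (intro real_le_lsqrt) (auto simp: power2_eq_square algebra_simps)
  show "shell_radius d t > 0"
    using lower assms by linarith
qed

lemma shell_radius_strict_antimono:
  assumes "d > 1" "0 \<le> s" "s < t" "t \<le> pi"
  shows "shell_radius d t < shell_radius d s"
  using assms cos_monotone_0_pi[of s t] by (simp add: shell_radius_def)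

lemma norm_circle_point:
  assumes "d > 1"
  shows "norm (vector [d + cos t, sin t, 0] :: real^3) = shell_radius d t"
    "norm (vector [d + cos t, - sin t, 0] :: real^3) = shell_radius d t"
proof -
  have "(d + cos t)\<^sup>2 + (sin t)\<^sup>2 = d\<^sup>2 + 1 + 2 * d * cos t"
    using sin_cos_squared_add[of t] by (simp add: power2_eq_square algebra_simps)
  then show "norm (vector [d + cos t, sin t, 0] :: real^3) = shell_radius d t"
    "norm (vector [d + cos t, - sin t, 0] :: real^3) = shell_radius d t"
    by (simp_all add: norm_vec_def L2_set_def sum_3 shell_radius_def)
qed

definition shell_angle :: "real \<Rightarrow> real \<Rightarrow> real" where
  "shell_angle d r = arccos ((r\<^sup>2 - d\<^sup>2 - 1) / (2 * d))"

lemma shell_angle_arg: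
  fixes d r :: real
  assumes "d > 1" "r \<in> {d - 1..d + 1}"
  shows "(r\<^sup>2 - d\<^sup>2 - 1) / (2 * d) \<in> {-1..1}"
proof -
  have "(d - 1)\<^sup>2 \<le> r\<^sup>2" "r\<^sup>2 \<le> (d + 1)\<^sup>2"
    using assms power_mono[of "d - 1" r 2] power_mono[of r "d + 1" 2] by auto
  then show ?thesis
    using assms by (simp add: field_simps power2_eq_square)
qed

lemma shell_angle_range: "d > 1 \<Longrightarrow> r \<in> {d - 1..d + 1} \<Longrightarrow> shell_angle d r \<in> {0..pi}"
  using shell_angle_arg[of d r] by (auto simp: shell_angle_def arccos_lbound arccos_ubound)

lemma continuous_on_shell_angle: "d > 1 \<Longrightarrow> continuous_on {d - 1..d + 1} (shell_angle d)"
  unfolding shell_angle_def using shell_angle_arg[of d]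
  by (intro continuous_on_arccos continuous_intros) auto

lemma shell_angle_radius: "d > 1 \<Longrightarrow> t \<in> {0..pi} \<Longrightarrow> shell_angle d (shell_radius d t) = t"
proof -
  assume d: "d > 1" and t: "t \<in> {0..pi}"
  have "(shell_radius d t)\<^sup>2 = d\<^sup>2 + 1 + 2 * d * cos t"
    using shell_radius_bounds(3)[OF d, of t] by (simp add: shell_radius_def)
  then show ?thesis
    using d t by (simp add: shell_angle_def arccos_cos)
qed

lemma compact_unit_set_avoids_cap:
  fixes N :: "'a::euclidean_space"
  assumes "compact K" "\<And>x. x \<in> K \<Longrightarrow> norm x = 1" "N \<notin> K" "norm N = 1"
  obtains c where "0 < c" "c < 1" "\<And>x. x \<in> K \<Longrightarrow> N \<bullet> x < c"
proof (cases "K = {}")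
  case True
  then show ?thesis using that[of "1/2"] by auto
next
  case False
  have "continuous_on K (\<lambda>x. N \<bullet> x)"
    by (intro continuous_intros)
  then obtain y where y: "y \<in> K" "\<And>x. x \<in> K \<Longrightarrow> N \<bullet> x \<le> N \<bullet> y"
    using continuous_attains_sup[OF assms(1) False] by blast
  have "N \<bullet> y < 1"
  proof -
    have "N \<bullet> y \<noteq> 1"
      using assms y(1) norm_cauchy_schwarz_eq[of N y] by auto
    moreover have "N \<bullet> y \<le> 1"
      using norm_cauchy_schwarz[of N y] assms y(1) by simp
    ultimately show ?thesis by simp
  qed
  then obtain c where "max 0 (N \<bullet> y) < c" "c < 1" using dense[of "max 0 (N \<bullet> y)" 1] by auto
  then show ?thesis using that[of c] y(2) by fastforce
qed

lemma ambient_isotopic_translation: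
  fixes v :: "'a::real_normed_vector"
  shows "ambient_isotopic S ((\<lambda>x. x + v) ` S)"
proof -
  have "ambient_isotopic S ((\<lambda>x. x + 1 *\<^sub>R v) ` S)"
    by (rule ambient_isotopicI[where G = "\<lambda>s x. x - s *\<^sub>R v"])
      (auto simp: case_prod_unfold intro!: continuous_intros)
  then show ?thesis by simp
qed

lemma standard_unlink_eq:
  "standard_unlink n = (\<Union>k<n. \<Union>t\<in>{0..pi}. {vector [3 * real k + cos t, - sin t, 0], vector [3 * real k + cos t, sin t, 0]})"
proof -
  have "\<exists>t\<in>{0..pi}. Re z = cos t \<and> (Im z = - sin t \<or> Im z = sin t)" if "norm z = 1" for z
  proof -
    have "z = cis (Arg z)" using that by (metis complex_norm_eq_1_exp_eq cis_conv_exp mult.commute norm_zero rcis_cmod_Arg zero_neq_one rcis_def mult_1 of_real_1)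
    then have "Re z = cos (Arg z)" "Im z = sin (Arg z)" by (metis cis.sel)+
    moreover have "-pi < Arg z" "Arg z \<le> pi" by (simp_all add: mpi_less_Arg Arg_le_pi)
    ultimately show ?thesis
      by (intro bexI[of _ "\<bar>Arg z\<bar>"]) (auto simp: abs_if)
  qed
  then have "standard_unlink n \<subseteq> (\<Union>k<n. \<Union>t\<in>{0..pi}. {vector [3 * real k + cos t, - sin t, 0], vector [3 * real k + cos t, sin t, 0]})"
    unfolding standard_unlink_def by fastforce
  moreover have "vector [3 * real k + cos t, sin t, 0] \<in> standard_unlink n" if "k < n" for k t
    unfolding standard_unlink_def using that by (auto intro!: exI[of _ k] exI[of _ "cis t"])
  from this[of _ t for t] this[of _ "- t" for t] have "(\<Union>k<n. \<Union>t\<in>{0..pi}. {vector [3 * real k + cos t, - sin t, 0], vector [3 * real k + cos t, sin t, 0]}) \<subseteq> standard_unlink n"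
    by fastforce
  ultimately show ?thesis by blast
qed

text \<open>
  After pushing away from \<open>N\<close> and applying the affine normal forms, the points of \<open>P k\<close> and \<open>Q k\<close> at
  parameter \<open>t\<close> lie on the rays through \<open>(d + cos t, -sin t, 0)\<close> and \<open>(d + cos t, sin t, 0)\<close>.
  The radius was chosen to be the norm of these vectors, and it has not changed, so the
  points are these vectors. They form the unit circle with centre \<open>(3 k + 3, 0, 0)\<close>.
\<close>

lemma two_strand_link_is_unlink:
  fixes P Q W :: "nat \<Rightarrow> real \<Rightarrow> real^3" and N :: "real^3"
  defines "d \<equiv> \<lambda>k. 3 * real k + 3"
  assumes cont: "\<And>k. k < n \<Longrightarrow> continuous_on {0..pi} (P k)" "\<And>k. k < n \<Longrightarrow> continuous_on {0..pi} (Q k)"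
      "\<And>k. k < n \<Longrightarrow> continuous_on {0..pi} (W k)"
    and unit: "\<And>k t. k < n \<Longrightarrow> t \<in> {0..pi} \<Longrightarrow> norm (P k t) = 1" "\<And>k t. k < n \<Longrightarrow> t \<in> {0..pi} \<Longrightarrow> norm (Q k t) = 1"
    and W: "\<And>k t. k < n \<Longrightarrow> t \<in> {0..pi} \<Longrightarrow> Q k t - P k t = sin t *\<^sub>R W k t"
      "\<And>k t. k < n \<Longrightarrow> t \<in> {0..pi} \<Longrightarrow> W k t \<noteq> 0"
    and ends: "\<And>k. k < n \<Longrightarrow> W k 0 \<bullet> P k 0 = 0" "\<And>k. k < n \<Longrightarrow> W k pi \<bullet> P k pi = 0"
    and N: "norm N = 1" "N $ 1 < 0"
    and avoid: "\<And>k t. k < n \<Longrightarrow> t \<in> {0..pi} \<Longrightarrow> P k t \<noteq> N" "\<And>k t. k < n \<Longrightarrow> t \<in> {0..pi} \<Longrightarrow> Q k t \<noteq> N"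
  shows "ambient_isotopic
    (\<Union>k<n. \<Union>t\<in>{0..pi}. {shell_radius (d k) t *\<^sub>R P k t, shell_radius (d k) t *\<^sub>R Q k t}) (standard_unlink n)"
proof -
  have d: "d k > 1" for k by (simp add: d_def)
  obtain c where c: "0 < c" "c < 1"
    and less_c: "\<And>k t. k < n \<Longrightarrow> t \<in> {0..pi} \<Longrightarrow> N \<bullet> P k t < c" "\<And>k t. k < n \<Longrightarrow> t \<in> {0..pi} \<Longrightarrow> N \<bullet> Q k t < c"
  proof -
    let ?K = "\<Union>k<n. P k ` {0..pi} \<union> Q k ` {0..pi}"
    have K: "compact ?K"
      using cont by (intro compact_UN compact_Un compact_continuous_image) auto
    have K1: "norm x = 1" if "x \<in> ?K" for x using that unit by auto
    have NK: "N \<notin> ?K"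
    proof
      assume "N \<in> ?K"
      then obtain k t where "k < n" "t \<in> {0..pi}" "N = P k t \<or> N = Q k t" by blast
      then show False using avoid[of k t] by metis
    qed
    obtain c where c: "0 < c" "c < 1" "\<And>x. x \<in> ?K \<Longrightarrow> N \<bullet> x < c"
      using compact_unit_set_avoids_cap[OF K K1 NK N(1)] by blast
    show ?thesis
    proof (rule that[OF c(1,2)])
      fix k t assume "k < n" "t \<in> {0..pi}"
      then show "N \<bullet> P k t < c" "N \<bullet> Q k t < c" by (blast intro: c(3))+
    qed
  qed
  have "\<exists>\<mu> q. continuous_on {0..pi} \<mu> \<and> continuous_on {0..pi} q \<and> (\<forall>t\<in>{0..pi}.
     exp (\<mu> t) * plane_coord (P k t - c *\<^sub>R N) + q t * of_real (N \<bullet> (P k t - c *\<^sub>R N))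
        = of_real (N \<bullet> (P k t - c *\<^sub>R N) * (sin t / (d k + cos t))) \<and>
     exp (\<mu> t) * plane_coord (Q k t - c *\<^sub>R N) + q t * of_real (N \<bullet> (Q k t - c *\<^sub>R N))
        = - of_real (N \<bullet> (Q k t - c *\<^sub>R N) * (sin t / (d k + cos t))))" if k: "k < n" for k
    using two_strands_affine_normal_form[OF cont(1,2,3)[OF k] unit(1,2)[OF k] W(1,2)[OF k] ends[OF k] N c less_c[OF k] d[of k]]
    by metis
  then obtain \<mu> q where
    \<mu>q: "\<And>k. k < n \<Longrightarrow> continuous_on {0..pi} (\<mu> k)" "\<And>k. k < n \<Longrightarrow> continuous_on {0..pi} (q k)"
    and eqP: "\<And>k t. k < n \<Longrightarrow> t \<in> {0..pi} \<Longrightarrow>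
      exp (\<mu> k t) * plane_coord (P k t - c *\<^sub>R N) + q k t * of_real (N \<bullet> (P k t - c *\<^sub>R N))
        = of_real (N \<bullet> (P k t - c *\<^sub>R N) * (sin t / (d k + cos t)))"
    and eqQ: "\<And>k t. k < n \<Longrightarrow> t \<in> {0..pi} \<Longrightarrow>
      exp (\<mu> k t) * plane_coord (Q k t - c *\<^sub>R N) + q k t * of_real (N \<bullet> (Q k t - c *\<^sub>R N))
        = - of_real (N \<bullet> (Q k t - c *\<^sub>R N) * (sin t / (d k + cos t)))"
    by metis
  have extend: "\<exists>F. continuous_on UNIV F \<and> (\<forall>k<n. \<forall>t\<in>{0..pi}. F (shell_radius (d k) t) = f k t)"
    if f: "\<And>k. k < n \<Longrightarrow> continuous_on {0..pi} (f k)" for f :: "nat \<Rightarrow> real \<Rightarrow> complex"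
  proof -
    have "\<exists>F. continuous_on UNIV F \<and> (\<forall>k<n. \<forall>r\<in>{d k - 1..d k + 1}. F r = f k (shell_angle (d k) r))"
    proof (rule continuous_extension_from_disjoint_closed)
      show "continuous_on {d k - 1..d k + 1} (\<lambda>r. f k (shell_angle (d k) r))" if "k < n" for k
        using shell_angle_range[OF d]
        by (intro continuous_on_compose2[OF f[OF that] continuous_on_shell_angle[OF d]]) blast
      show "{d j - 1..d j + 1} \<inter> {d k - 1..d k + 1} = {}" if "j < k" for j k
        using that by (auto simp: d_def)
    qed auto
    then obtain F where F: "continuous_on UNIV F"
      "\<And>k r. k < n \<Longrightarrow> r \<in> {d k - 1..d k + 1} \<Longrightarrow> F r = f k (shell_angle (d k) r)"
      by blast
    have "F (shell_radius (d k) t) = f k t" if "k < n" "t \<in> {0..pi}" for k t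
      using F(2)[of k "shell_radius (d k) t"] shell_radius_bounds[OF d, of k t]
        shell_angle_radius[OF d that(2)] that by simp
    then show ?thesis using F(1) by blast
  qed
  obtain m where m: "continuous_on UNIV m" "\<And>k t. k < n \<Longrightarrow> t \<in> {0..pi} \<Longrightarrow> m (shell_radius (d k) t) = \<mu> k t"
    using extend[of \<mu>, OF \<mu>q(1)] by blast
  obtain p where p: "continuous_on UNIV p" "\<And>k t. k < n \<Longrightarrow> t \<in> {0..pi} \<Longrightarrow> p (shell_radius (d k) t) = q k t"
    using extend[of q, OF \<mu>q(2)] by blast
  define A where "A r x = (let Z = exp (m r) * plane_coord x + p r * of_real (N \<bullet> x)
                     in vector [- (N \<bullet> x), Re Z, Im Z] :: real^3)" for r x
  let ?F1 = "\<lambda>x. norm x *\<^sub>R sgn (x - (c * norm x) *\<^sub>R N)" and ?F2 = "\<lambda>x. norm x *\<^sub>R sgn (A (norm x) x)"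
    and ?F3 = "\<lambda>x. x + vector [-3, 0, 0] :: real^3"
  let ?S = "\<Union>k<n. \<Union>t\<in>{0..pi}. {shell_radius (d k) t *\<^sub>R P k t, shell_radius (d k) t *\<^sub>R Q k t}"
  have F_ray: "?F2 (?F1 (r *\<^sub>R x)) = y"
    if r: "r > 0" and x: "norm x = 1" "N \<bullet> x < c" and y: "norm y = r"
      and l: "l > 0" "A r (x - c *\<^sub>R N) = l *\<^sub>R y" for r x y l
  proof -
    let ?v = "x - c *\<^sub>R N"
    have NN: "N \<bullet> N = 1" using N(1) by (simp add: norm_eq_1)
    have "N \<bullet> ?v < 0" using x(2) NN by (simp add: inner_diff_right)
    then have v: "?v \<noteq> 0" by (metis inner_zero_right less_irrefl)
    have A_scale: "A r (t *\<^sub>R z) = t *\<^sub>R A r z" for t z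
      by (simp add: A_def Let_def plane_coord_scaleR vec_eq_iff forall_3 algebra_simps)
    have "r *\<^sub>R x - (c * norm (r *\<^sub>R x)) *\<^sub>R N = r *\<^sub>R ?v"
      using r x by (simp add: algebra_simps)
    then have F1: "?F1 (r *\<^sub>R x) = (r / norm ?v) *\<^sub>R ?v"
      using r x by (simp add: sgn_scaleR_pos) (simp add: sgn_div_norm divide_inverse)
    have nF1: "norm ((r / norm ?v) *\<^sub>R ?v) = r" using r v by simp
    have "?F2 ((r / norm ?v) *\<^sub>R ?v) = r *\<^sub>R sgn ((r / norm ?v) *\<^sub>R l *\<^sub>R y)"
      unfolding nF1 A_scale l(2) ..
    also have "\<dots> = r *\<^sub>R sgn y"
      using r v l(1) by (simp add: sgn_scaleR_pos del: scaleR_scaleR)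
    also have "\<dots> = y" using y r by (simp add: sgn_div_norm)
    finally show ?thesis unfolding F1 .
  qed
  have NN: "N \<bullet> N = 1" using N(1) by (simp add: norm_eq_1)
  have dcos: "d k + cos t > 0" for k t using d[of k] cos_ge_minus_one[of t] by linarith
  have F_P: "?F2 (?F1 (shell_radius (d k) t *\<^sub>R P k t)) = vector [d k + cos t, - sin t, 0]" if "k < n" "t \<in> {0..pi}" for k t
  proof (rule F_ray[where l = "- (N \<bullet> (P k t - c *\<^sub>R N)) / (d k + cos t)"])
    have "N \<bullet> (P k t - c *\<^sub>R N) < 0" using less_c(1)[OF that] NN by (simp add: inner_diff_right)
    then show "- (N \<bullet> (P k t - c *\<^sub>R N)) / (d k + cos t) > 0" using dcos[of k t] by (simp add: divide_neg_pos)
    show "A (shell_radius (d k) t) (P k t - c *\<^sub>R N) =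
      (- (N \<bullet> (P k t - c *\<^sub>R N)) / (d k + cos t)) *\<^sub>R vector [d k + cos t, - sin t, 0]"
      using dcos[of k t] unfolding A_def m(2)[OF that] p(2)[OF that] eqP[OF that] Let_def
      by (simp add: vec_eq_iff forall_3)
  qed (use that unit less_c shell_radius_bounds[OF d] norm_circle_point[OF d] in auto)
  have F_Q: "?F2 (?F1 (shell_radius (d k) t *\<^sub>R Q k t)) = vector [d k + cos t, sin t, 0]" if "k < n" "t \<in> {0..pi}" for k t
  proof (rule F_ray[where l = "- (N \<bullet> (Q k t - c *\<^sub>R N)) / (d k + cos t)"])
    have "N \<bullet> (Q k t - c *\<^sub>R N) < 0" using less_c(2)[OF that] NN by (simp add: inner_diff_right)
    then show "- (N \<bullet> (Q k t - c *\<^sub>R N)) / (d k + cos t) > 0" using dcos[of k t] by (simp add: divide_neg_pos)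
    show "A (shell_radius (d k) t) (Q k t - c *\<^sub>R N) =
      (- (N \<bullet> (Q k t - c *\<^sub>R N)) / (d k + cos t)) *\<^sub>R vector [d k + cos t, sin t, 0]"
      using dcos[of k t] unfolding A_def m(2)[OF that] p(2)[OF that] eqQ[OF that] Let_def
      by (simp add: vec_eq_iff forall_3)
  qed (use that unit less_c shell_radius_bounds[OF d] norm_circle_point[OF d] in auto)
  have shift: "vector [d k + cos t, y, 0] + vector [-3, 0, 0] = (vector [3 * real k + cos t, y, 0] :: real^3)" for k t y
    by (simp add: vec_eq_iff forall_3 d_def)
  have image: "?F3 ` ?F2 ` ?F1 ` ?S = standard_unlink n"
    unfolding standard_unlink_eq image_UN image_insert image_empty
    by (intro SUP_cong refl) (simp only: lessThan_iff F_P F_Q shift)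
  have push: "ambient_isotopic ?S (?F1 ` ?S)"
    by (rule ambient_isotopic_push_from_point[OF N(1) less_imp_le[OF c(1)] c(2)])
  have straighten: "ambient_isotopic (?F1 ` ?S) (?F2 ` ?F1 ` ?S)"
    unfolding A_def by (rule ambient_isotopic_affine_on_central_planes[OF N(2) m(1) p(1)])
  have "ambient_isotopic (?F2 ` ?F1 ` ?S) (?F3 ` ?F2 ` ?F1 ` ?S)"
    by (rule ambient_isotopic_translation)
  from ambient_isotopic_trans[OF ambient_isotopic_trans[OF push straighten] this] show ?thesis
    unfolding image .
qed

section \<open>Loops on the sphere as pairs of strands\<close>

lemma orthogonal_vector_derivative_if_norm_1:
  fixes g :: "real \<Rightarrow> 'a::real_inner"
  assumes "(g has_vector_derivative g') (at t)" "\<And>t. norm (g t) = 1"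
  shows "g' \<bullet> g t = 0"
proof -
  have "((\<lambda>t. g t \<bullet> g t) has_real_derivative (g t \<bullet> g' + g' \<bullet> g t)) (at t)"
    unfolding has_field_derivative_def
    by (rule has_derivative_eq_rhs[OF has_derivative_inner[OF assms(1)[unfolded has_vector_derivative_def]
          assms(1)[unfolded has_vector_derivative_def]]]) (simp add: fun_eq_iff algebra_simps)
  moreover have "(\<lambda>t. g t \<bullet> g t) = (\<lambda>t. 1)"
    using assms(2) by (simp add: norm_eq_1)
  ultimately have "((\<lambda>t::real. 1) has_real_derivative (g t \<bullet> g' + g' \<bullet> g t)) (at t)"
    by simp
  then have "g t \<bullet> g' + g' \<bullet> g t = 0"
    using DERIV_unique[OF _ DERIV_const] by blast
  then show ?thesis by (simp add: inner_commute)
qed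

lemma tendsto_quotient_of_vector_derivatives:
  fixes f :: "real \<Rightarrow> 'a::real_normed_vector" and s :: "real \<Rightarrow> real"
  assumes "(f has_vector_derivative f') (at x)" "(s has_real_derivative s') (at x)"
    and "f x = 0" "s x = 0" "s' \<noteq> 0"
  shows "((\<lambda>t. f t /\<^sub>R s t) \<longlongrightarrow> f' /\<^sub>R s') (at x)"
proof -
  have "((\<lambda>t. inverse (t - x) *\<^sub>R f t) \<longlongrightarrow> f') (at x)"
  proof -
    have "((\<lambda>t. norm (f t - f x - (t - x) *\<^sub>R f') / norm (t - x)) \<longlongrightarrow> 0) (at x)"
      using assms(1) by (simp add: has_vector_derivative_def has_derivative_iff_norm)
    then have "((\<lambda>t. norm (inverse (t - x) *\<^sub>R f t - f')) \<longlongrightarrow> 0) (at x)"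
    proof (rule Lim_transform_eventually)
      have "norm (f t - f x - (t - x) *\<^sub>R f') / norm (t - x) = norm (inverse (t - x) *\<^sub>R f t - f')" if "t \<noteq> x" for t
      proof -
        have "inverse (t - x) *\<^sub>R f t - f' = inverse (t - x) *\<^sub>R (f t - f x - (t - x) *\<^sub>R f')"
          using that assms(3) by (simp add: scaleR_diff_right)
        then show ?thesis
          by (simp add: divide_inverse mult.commute)
      qed
      then show "\<forall>\<^sub>F t in at x. norm (f t - f x - (t - x) *\<^sub>R f') / norm (t - x) = norm (inverse (t - x) *\<^sub>R f t - f')"
        by (auto simp: eventually_at intro!: exI[of _ 1])
    qed
    then show ?thesis
      using Lim_null tendsto_norm_zero_iff by blast
  qed
  moreover have "((\<lambda>t. s t / (t - x)) \<longlongrightarrow> s') (at x)"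
    using assms(2,4) by (simp add: has_field_derivative_iff)
  ultimately have "((\<lambda>t. inverse (s t / (t - x)) *\<^sub>R (inverse (t - x) *\<^sub>R f t)) \<longlongrightarrow> inverse s' *\<^sub>R f') (at x)"
    using assms(5) by (intro tendsto_scaleR tendsto_inverse)
  then show ?thesis
    by (rule Lim_transform_eventually) (auto simp: eventually_at inverse_eq_divide intro!: exI[of _ 1])
qed

text \<open>
  The loop \<open>g\<close> is cut at the parameters \<open>0\<close> and \<open>b\<close>, and both pieces are traversed from \<open>0\<close> to \<open>b\<close>
  over the time \<open>[0, \<pi>]\<close>. At the two cutting points the pieces leave in opposite directions, so
  \<open>Q - P\<close> has the derivatives \<open>- 2 g'(0)\<close> and \<open>- 2 g'(b)\<close> there; division by \<open>sin\<close>, whose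
  derivatives are \<open>1\<close> and \<open>-1\<close>, gives nonzero limits tangent to the sphere.
\<close>

lemma loop_in_two_strands:
  fixes g g' :: "real \<Rightarrow> 'a::euclidean_space" and b :: real
  assumes periodic: "\<And>t. g (t - 2 * pi) = g t"
    and deriv: "\<And>t. (g has_vector_derivative g' t) (at t)" "\<And>t. g' t \<noteq> 0"
    and unit: "\<And>t. norm (g t) = 1" and b: "0 < b" "b < 2 * pi"
  defines "P \<equiv> \<lambda>t. g (b * t / pi)" and "Q \<equiv> \<lambda>t. g (2 * pi - (2 * pi - b) * t / pi)"
  assumes ne: "\<And>t. 0 < t \<Longrightarrow> t < pi \<Longrightarrow> P t \<noteq> Q t"
  obtains W where "continuous_on {0..pi} P" "continuous_on {0..pi} Q" "continuous_on {0..pi} W"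
    "\<And>t. t \<in> {0..pi} \<Longrightarrow> Q t - P t = sin t *\<^sub>R W t"
    "\<And>t. t \<in> {0..pi} \<Longrightarrow> W t \<noteq> 0" "W 0 \<bullet> P 0 = 0" "W pi \<bullet> P pi = 0"
proof -
  have g'_periodic: "g' (t - 2 * pi) = g' t" for t
  proof (rule vector_derivative_unique_at)
    have "((\<lambda>s. s + 2 * pi) has_vector_derivative 1) (at (t - 2 * pi))"
      by (auto intro!: derivative_eq_intros)
    then have "(g \<circ> (\<lambda>s. s + 2 * pi) has_vector_derivative 1 *\<^sub>R g' t) (at (t - 2 * pi))"
      using deriv(1)[of t] by (intro vector_diff_chain_at) simp_all
    moreover have "g \<circ> (\<lambda>s. s + 2 * pi) = g"
      using periodic[of "_ + 2 * pi"] by (auto simp: fun_eq_iff)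
    ultimately show "(g has_vector_derivative g' t) (at (t - 2 * pi))" by simp
  qed (rule deriv)
  have dP: "(P has_vector_derivative (b / pi) *\<^sub>R g' (b * t / pi)) (at t)" for t
  proof -
    have "((\<lambda>t. b * t / pi) has_vector_derivative b / pi) (at t)"
      by (auto intro!: derivative_eq_intros)
    from vector_diff_chain_at[OF this deriv(1)] show ?thesis by (simp add: P_def o_def)
  qed
  have dQ: "(Q has_vector_derivative (- (2 * pi - b) / pi) *\<^sub>R g' (2 * pi - (2 * pi - b) * t / pi)) (at t)" for t
  proof -
    have "((\<lambda>t. 2 * pi - (2 * pi - b) * t / pi) has_vector_derivative - (2 * pi - b) / pi) (at t)"
      by (auto intro!: derivative_eq_intros simp: field_simps)
    from vector_diff_chain_at[OF this deriv(1)] show ?thesis by (simp add: Q_def o_def)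
  qed
  have dQP: "((\<lambda>t. Q t - P t) has_vector_derivative
      (- (2 * pi - b) / pi) *\<^sub>R g' (2 * pi - (2 * pi - b) * t / pi) - (b / pi) *\<^sub>R g' (b * t / pi)) (at t)" for t
    by (intro derivative_intros dP dQ)
  have ends: "Q 0 = P 0" "Q pi = P pi"
    using periodic[of "2 * pi"] by (simp_all add: P_def Q_def)
  have coef: "- (2 * pi - b) / pi - b / pi = -2"
    by (simp add: field_simps)
  define W where "W t = (if t = 0 then - 2 *\<^sub>R g' 0 else if t = pi then 2 *\<^sub>R g' b else (Q t - P t) /\<^sub>R sin t)" for t
  have dQP_0: "((\<lambda>t. Q t - P t) has_vector_derivative - 2 *\<^sub>R g' 0) (at 0)"
    using dQP[of 0] g'_periodic[of "2 * pi"] coef by (simp flip: scaleR_diff_left)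
  have dQP_pi: "((\<lambda>t. Q t - P t) has_vector_derivative - 2 *\<^sub>R g' b) (at pi)"
    using dQP[of pi] coef by (simp flip: scaleR_diff_left)
  have lim_0: "((\<lambda>t. (Q t - P t) /\<^sub>R sin t) \<longlongrightarrow> W 0) (at 0)"
    using tendsto_quotient_of_vector_derivatives[OF dQP_0, of sin 1] DERIV_sin[of 0] ends
    by (simp add: W_def)
  have lim_pi: "((\<lambda>t. (Q t - P t) /\<^sub>R sin t) \<longlongrightarrow> W pi) (at pi)"
    using tendsto_quotient_of_vector_derivatives[OF dQP_pi, of sin "-1"] DERIV_sin[of pi] ends
    by (simp add: W_def)
  have cont_PQ: "isCont P t" "isCont Q t" for t
    using dP dQ by (auto intro: has_vector_derivative_continuous)
  have W_tendsto: "(W \<longlongrightarrow> W t) (at t within {0..pi})" if t: "t \<in> {0..pi}" for t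
  proof -
    have "((\<lambda>t. (Q t - P t) /\<^sub>R sin t) \<longlongrightarrow> W t) (at t within {0..pi})"
    proof (cases "t = 0 \<or> t = pi")
      case True
      then show ?thesis
        using lim_0 lim_pi by (auto intro: tendsto_within_subset)
    next
      case False
      then have "sin t > 0" using t by (intro sin_gt_zero) auto
      then have "isCont (\<lambda>t. (Q t - P t) /\<^sub>R sin t) t"
        using cont_PQ by (intro continuous_intros) auto
      then show ?thesis
        using False by (auto simp: W_def isCont_def intro: tendsto_within_subset)
    qed
    moreover have "\<forall>\<^sub>F s in at t within {0..pi}. (Q s - P s) /\<^sub>R sin s = W s"
    proof -
      have "\<forall>\<^sub>F s in at t within {0..pi}. s \<noteq> 0" "\<forall>\<^sub>F s in at t within {0..pi}. s \<noteq> pi"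
        by (rule eventually_neq_at_within)+
      then show ?thesis by eventually_elim (simp add: W_def)
    qed
    ultimately show ?thesis by (rule Lim_transform_eventually)
  qed
  show ?thesis
  proof
    show "continuous_on {0..pi} P" "continuous_on {0..pi} Q"
      using cont_PQ by (auto intro: continuous_at_imp_continuous_on)
    show "continuous_on {0..pi} W"
      using W_tendsto by (simp add: continuous_on_def)
    fix t :: real assume t: "t \<in> {0..pi}"
    have sin: "sin t > 0" if "t \<noteq> 0" "t \<noteq> pi" using t that by (intro sin_gt_zero) auto
    show "Q t - P t = sin t *\<^sub>R W t"
      using sin ends by (auto simp: W_def)
    show "W t \<noteq> 0"
      using sin ne[of t] t deriv(2) by (auto simp: W_def)
  next
    show "W 0 \<bullet> P 0 = 0"
      using orthogonal_vector_derivative_if_norm_1[OF deriv(1) unit, of 0] by (simp add: W_def P_def)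
    show "W pi \<bullet> P pi = 0"
      using orthogonal_vector_derivative_if_norm_1[OF deriv(1) unit, of b] by (simp add: W_def P_def)
  qed
qed

text \<open>
  The cone over a differentiable curve is the image of a plane, so it has measure zero in space.
  It does not cover the open half-space of vectors with negative first coordinate.
\<close>

lemma exists_unit_vector_off_curves:
  fixes G :: "nat \<Rightarrow> real \<Rightarrow> real^3"
  assumes "\<And>i t. i < n \<Longrightarrow> G i differentiable (at t)"
  shows "\<exists>N. norm N = 1 \<and> N $ 1 < 0 \<and> (\<forall>i<n. \<forall>t. G i t \<noteq> N)"
proof -
  let ?cone = "\<lambda>i. (\<lambda>(s, t). s *\<^sub>R G i t) ` (UNIV :: (real \<times> real) set)"
  have "negligible (?cone i)" if "i < n" for i
  proof (rule negligible_differentiable_image_lowdim)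
    have "(\<lambda>p. fst p *\<^sub>R G i (snd p)) differentiable (at p)" for p :: "real \<times> real"
    proof (rule differentiable_scaleR)
      have "(G i \<circ> snd) differentiable (at p)"
        using assms[OF that] by (intro differentiable_chain_at) (auto intro: bounded_linear_imp_differentiable bounded_linear_snd)
      then show "(\<lambda>p. G i (snd p)) differentiable (at p)" by (simp add: o_def)
    qed (auto intro: bounded_linear_imp_differentiable bounded_linear_fst)
    then show "(\<lambda>(s, t). s *\<^sub>R G i t) differentiable_on UNIV"
      by (auto simp: differentiable_on_def case_prod_unfold intro: differentiable_at_withinI)
  qed simp
  then have "negligible (\<Union>i<n. ?cone i)"
    by (intro negligible_Union) auto
  moreover have "open {x :: real^3. x $ 1 < 0}"
    by (intro open_Collect_less continuous_intros)
  moreover have "(- axis 1 1 :: real^3) \<in> {x. x $ 1 < 0}"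
    by (simp add: axis_def)
  ultimately obtain x :: "real^3" where x: "x $ 1 < 0" "x \<notin> (\<Union>i<n. ?cone i)"
    using open_not_negligible negligible_subset by (metis (no_types, lifting) empty_iff mem_Collect_eq subsetI)
  have "G i t \<noteq> sgn x" if "i < n" for i t
  proof
    assume "G i t = sgn x"
    then have "x = norm x *\<^sub>R G i t" by (cases "x = 0") (simp_all add: sgn_div_norm)
    then have "x \<in> ?cone i" by (intro image_eqI[of _ _ "(norm x, t)"]) auto
    then show False using x(2) that by blast
  qed
  moreover have "x \<noteq> 0" using x(1) by auto
  ultimately show ?thesis
    using x(1) by (intro exI[of _ "sgn x"]) (auto simp: norm_sgn sgn_div_norm mult_pos_neg)
qed

lemma cis_Arg2pi_unit: "norm z = 1 \<Longrightarrow> cis (Arg2pi z) = z"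
  using complex_norm_eq_1_exp[of z] by (simp add: cis_conv_exp)

lemma Arg2pi_cis: "0 \<le> t \<Longrightarrow> t < 2 * pi \<Longrightarrow> Arg2pi (cis t) = t"
  by (rule Arg2pi_unique[of 1]) (simp_all add: cis_conv_exp)

text \<open>
  \<open>Arg2pi\<close> jumps at \<open>1\<close>, but the circle is a compact quotient of the interval \<open>[0, 2 \<pi>]\<close>.
\<close>

lemma continuous_on_circle_by_angle:
  fixes f :: "real \<Rightarrow> 'a::topological_space"
  assumes cont: "continuous_on {0..2 * pi} f" and "f 0 = f (2 * pi)" and a: "norm a = 1"
  shows "continuous_on (sphere 0 1) (\<lambda>z. f (Arg2pi (z / a)))"
proof -
  have "closed ((\<lambda>z. f (Arg2pi (z / a))) -` B \<inter> sphere 0 1)" if "closed B" for B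
  proof -
    have "(\<lambda>z. f (Arg2pi (z / a))) -` B \<inter> sphere 0 1 = (\<lambda>t. a * cis t) ` (f -` B \<inter> {0..2 * pi})"
    proof (intro equalityI subsetI)
      fix z assume z: "z \<in> (\<lambda>z. f (Arg2pi (z / a))) -` B \<inter> sphere 0 1"
      then have "z = a * cis (Arg2pi (z / a))"
        using a by (subst cis_Arg2pi_unit) (auto simp: norm_divide)
      then show "z \<in> (\<lambda>t. a * cis t) ` (f -` B \<inter> {0..2 * pi})"
        using z Arg2pi[of "z / a"] by (intro image_eqI[of _ _ "Arg2pi (z / a)"]) auto
    next
      fix z assume "z \<in> (\<lambda>t. a * cis t) ` (f -` B \<inter> {0..2 * pi})"
      then obtain t where t: "f t \<in> B" "0 \<le> t" "t \<le> 2 * pi" and z: "z = a * cis t" by auto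
      have "z / a = cis t" using a z by auto
      moreover have "f (Arg2pi (cis t)) = f t"
      proof (cases "t = 2 * pi")
        case True
        then show ?thesis using assms(2) Arg2pi_cis[of 0] by (simp add: cis_2pi)
      next
        case False
        then show ?thesis using t Arg2pi_cis by simp
      qed
      ultimately show "z \<in> (\<lambda>z. f (Arg2pi (z / a))) -` B \<inter> sphere 0 1"
        using t a z by (simp add: norm_mult)
    qed
    moreover have "compact (f -` B \<inter> {0..2 * pi})"
      using cont that continuous_closed_preimage[OF cont closed_atLeastAtMost that]
      by (metis Int_commute closed_Int_compact compact_Icc inf.right_idem)
    ultimately show ?thesis
      by (auto intro!: compact_imp_closed compact_continuous_image continuous_intros)
  qed
  then show ?thesis
    by (subst continuous_on_closed_vimage) auto
qed

text \<open>
  The piecewise linear function that rises from \<open>0\<close> to \<open>\<pi>\<close> on \<open>[0, b]\<close> and falls back to \<open>0\<close> on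
  \<open>[b, 2 \<pi>]\<close>. It converts the angle travelled from the base point into the common time of the two
  strands in \<open>loop_in_two_strands\<close>.
\<close>

definition fold_angle :: "real \<Rightarrow> real \<Rightarrow> real" where
  "fold_angle b t = min (pi * t / b) (pi * (2 * pi - t) / (2 * pi - b))"

lemma fold_angle_down: "0 < b \<Longrightarrow> b < 2 * pi \<Longrightarrow> t \<le> b \<Longrightarrow> fold_angle b t = pi * t / b"
proof -
  assume b: "0 < b" "b < 2 * pi" and t: "t \<le> b"
  have "pi * t / b \<le> pi" using b t by (simp add: divide_le_eq)
  moreover have "pi \<le> pi * (2 * pi - t) / (2 * pi - b)" using b t by (simp add: le_divide_eq)
  ultimately show ?thesis by (simp add: fold_angle_def)
qed

lemma fold_angle_up: "0 < b \<Longrightarrow> b < 2 * pi \<Longrightarrow> b \<le> t \<Longrightarrow> fold_angle b t = pi * (2 * pi - t) / (2 * pi - b)"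
proof -
  assume b: "0 < b" "b < 2 * pi" and t: "b \<le> t"
  have "pi \<le> pi * t / b" using b t by (simp add: le_divide_eq)
  moreover have "pi * (2 * pi - t) / (2 * pi - b) \<le> pi" using b t by (simp add: divide_le_eq)
  ultimately show ?thesis by (simp add: fold_angle_def)
qed

lemma fold_angle_range:
  assumes "0 < b" "b < 2 * pi" "t \<in> {0..2 * pi}"
  shows "fold_angle b t \<in> {0..pi}"
proof (cases "t \<le> b")
  case True
  then show ?thesis using assms by (simp add: fold_angle_down divide_le_eq)
next
  case False
  then show ?thesis using assms by (simp add: fold_angle_up divide_le_eq)
qed

lemma continuous_on_fold_angle: "0 < b \<Longrightarrow> b < 2 * pi \<Longrightarrow> continuous_on S (fold_angle b)"
  unfolding fold_angle_def by (intro continuous_intros) auto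

section \<open>Descending diagrams\<close>

lemma mem_preim: "(i, z) \<in> preim D p \<longleftrightarrow> i < ncomp D \<and> norm z = 1 \<and> strand D i z = p"
  by (simp add: preim_def places_def dist_norm)

lemma crossing_places:
  assumes "link_diagram D" "p \<in> crossings D"
  obtains x y where "preim D p = {x, y}" "x \<noteq> y" "x \<in> overs D" "y \<notin> overs D"
proof -
  have "card (preim D p) = 2" and ex1: "\<exists>!x. x \<in> preim D p \<inter> overs D"
    using assms by (auto simp: link_diagram_def)
  then obtain u v where uv: "preim D p = {u, v}" "u \<noteq> v"
    by (auto simp: card_2_iff)
  show ?thesis
  proof (cases "u \<in> overs D")
    case True
    then have "v \<notin> overs D" using ex1 uv by auto
    then show ?thesis using that[of u v] uv True by blast
  next
    case False
    then have "v \<in> overs D" using ex1 uv by auto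
    then show ?thesis using that[of v u] uv False by (metis insert_commute)
  qed
qed

lemma finite_crossing_places:
  assumes "link_diagram D"
  shows "finite (\<Union>p\<in>crossings D. preim D p)"
proof (rule finite_UN_I)
  show "finite (crossings D)" using assms by (simp add: link_diagram_def)
  show "finite (preim D p)" if "p \<in> crossings D" for p
    using crossing_places[OF assms that] by (metis finite.emptyI finite.insertI)
qed

lemma norm_strand: "link_diagram D \<Longrightarrow> i < ncomp D \<Longrightarrow> norm z = 1 \<Longrightarrow> norm (strand D i z) = 1"
  by (auto simp: link_diagram_def image_subset_iff)

lemma strand_has_velocity:
  assumes "link_diagram D" "i < ncomp D" "norm a = 1"
  shows "((\<lambda>t. strand D i (a * cis t)) has_vector_derivative velocity D (i, a * cis t)) (at t)"
proof -
  let ?G = "\<lambda>t. strand D i (cis t)"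
  have a: "a = cis (Arg2pi a)" using assms(3) cis_Arg2pi_unit by simp
  define s where "s = Arg2pi a"
  have as: "a * cis u = cis (s + u)" "a * cis t * cis u = cis ((s + t) + u)" for u
    using a by (metis s_def cis_mult)+
  let ?v = "vector_derivative ?G (at (s + t))"
  have "?G differentiable at (s + t)"
    using assms(1,2) by (auto simp: link_diagram_def C1_differentiable_on_eq)
  then have G: "(?G has_vector_derivative ?v) (at (s + t))"
    by (simp add: vector_derivative_works)
  have shift: "((\<lambda>u. ?G (c + u)) has_vector_derivative ?v) (at u)" if "c + u = s + t" for c u
  proof -
    have "((\<lambda>u. c + u) has_vector_derivative 1) (at u)"
      by (auto intro!: derivative_eq_intros)
    from vector_diff_chain_at[OF this, of ?G ?v] G that show ?thesis by (simp add: o_def)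
  qed
  have "velocity D (i, a * cis t) = vector_derivative (\<lambda>u. ?G ((s + t) + u)) (at 0)"
    by (simp only: velocity_def case_prod_conv as(2))
  also have "\<dots> = ?v"
    using shift[of "s + t" 0] by (simp add: vector_derivative_at)
  finally show ?thesis
    using shift[of s t] by (simp add: as)
qed

lemma continuous_on_strand:
  assumes "link_diagram D" "i < ncomp D"
  shows "continuous_on (sphere 0 1) (strand D i)"
proof -
  let ?f = "\<lambda>t. strand D i (1 * cis t)"
  have "continuous_on {0..2 * pi} ?f"
    using strand_has_velocity[OF assms, of 1] by (intro continuous_at_imp_continuous_on ballI) (auto intro: has_vector_derivative_continuous)
  then have "continuous_on (sphere 0 1) (\<lambda>z. ?f (Arg2pi (z / 1)))"
    by (rule continuous_on_circle_by_angle) simp_all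
  then show ?thesis
    by (rule continuous_on_eq) (simp add: cis_Arg2pi_unit)
qed

text \<open>
  The base point is not at a crossing and there are only finitely many crossing places, so the last
  piece of the component before it returns to the base point is free of crossings.
\<close>

lemma crossing_free_arc:
  assumes D: "link_diagram D" and i: "i < ncomp D" and a: "norm a = 1" "strand D i a \<notin> crossings D"
  shows "\<exists>b. 0 < b \<and> b < 2 * pi \<and> (\<forall>t\<in>{b..2 * pi}. strand D i (a * cis t) \<notin> crossings D)"
proof -
  define X where "X = insert 1 ((\<lambda>(j, z). Arg2pi (z / a)) ` (\<Union>p\<in>crossings D. preim D p))"
  have "finite X" "X \<noteq> {}" using finite_crossing_places[OF D] by (auto simp: X_def)
  moreover have "x < 2 * pi" if "x \<in> X" for x
    using that Arg2pi pi_gt3 by (auto simp: X_def)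
  ultimately have m: "Max X < 2 * pi" "1 \<le> Max X" by (auto simp: X_def)
  let ?b = "(Max X + 2 * pi) / 2"
  have "strand D i (a * cis t) \<notin> crossings D" if t: "t \<in> {?b..2 * pi}" for t
  proof (cases "t = 2 * pi")
    case True
    then show ?thesis using a by (simp add: cis_2pi)
  next
    case False
    show ?thesis
    proof
      assume cr: "strand D i (a * cis t) \<in> crossings D"
      have "(i, a * cis t) \<in> preim D (strand D i (a * cis t))"
        using i a by (simp add: mem_preim norm_mult)
      then have "Arg2pi (a * cis t / a) \<in> X"
        unfolding X_def using cr by (intro insertI2 image_eqI[of _ _ "(i, a * cis t)"]) auto
      moreover have "Arg2pi (a * cis t / a) = t"
        using Arg2pi_cis[of t] t False m a by auto
      ultimately have "t \<le> Max X" using \<open>finite X\<close> by simp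
      then show False using t m by simp
    qed
  qed
  then show ?thesis using m by (intro exI[of _ ?b]) auto
qed

lemma coincident_places_cross:
  assumes "(i, z) \<in> places (ncomp D)" "(j, w) \<in> places (ncomp D)" "(i, z) \<noteq> (j, w)" "strand D i z = strand D j w"
  shows "strand D i z \<in> crossings D"
  unfolding crossings_def preim_def using assms by auto

text \<open>
  The link \<open>L\<close> sinks along each component up to the crossing-free arc, and components earlier in the
  base point sequence lie in outer shells. Without warping crossings the over-strand is then the
  outer one at every crossing, which also shows that \<open>L\<close> is injective.
\<close>

lemma trivial_if_no_warping_crossings:
  assumes D: "link_diagram D" and as: "base_point_seq D as" and no_warp: "warping_crossings D as = {}"
  shows "trivial_diagram D"
proof -
  define n where "n = ncomp D"
  have dist: "distinct (map fst as)" and set_as: "set (map fst as) = {..<n}"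
    and base: "\<And>i a. (i, a) \<in> set as \<Longrightarrow> norm a = 1 \<and> strand D i a \<notin> crossings D"
    using as by (auto simp: base_point_seq_def n_def)
  have len: "length as = n"
    using distinct_card[OF dist] set_as by simp
  \<comment> \<open>The list is read backwards: the last component occupies the innermost shell.\<close>
  define C where "C k = fst (as ! (n - 1 - k))" for k
  define a where "a k = snd (as ! (n - 1 - k))" for k
  have Ca: "(C k, a k) \<in> set as" if "k < n" for k
    using that len by (simp add: C_def a_def)
  have C_less: "C k < n" if "k < n" for k
    using Ca[OF that] set_as by force
  have inj_C: "inj_on C {..<n}"
  proof (rule inj_onI)
    fix k l assume "k \<in> {..<n}" "l \<in> {..<n}" "C k = C l"
    then have "n - 1 - k = n - 1 - l"
      using nth_eq_iff_index_eq[OF dist, of "n - 1 - k" "n - 1 - l"] len by (simp add: C_def)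
    then show "k = l" using \<open>k \<in> _\<close> \<open>l \<in> _\<close> by auto
  qed
  have img_C: "C ` {..<n} = {..<n}"
    using C_less inj_C by (intro endo_inj_surj) auto
  define pos where "pos = inv_into {..<n} C"
  have pos_C: "pos (C k) = k" if "k < n" for k
    using inj_C that by (simp add: pos_def inv_into_f_f)
  have C_pos: "C (pos i) = i" and pos_less: "pos i < n" if "i < n" for i
    using that img_C f_inv_into_f[of i C "{..<n}"] inv_into_into[of i C "{..<n}"] by (auto simp: pos_def)
  have a1: "norm (a k) = 1" and a_nc: "strand D (C k) (a k) \<notin> crossings D" if "k < n" for k
    using base[OF Ca[OF that]] by auto
  obtain b where b: "\<And>k. k < n \<Longrightarrow> 0 < b k" "\<And>k. k < n \<Longrightarrow> b k < 2 * pi"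
    and free: "\<And>k t. k < n \<Longrightarrow> t \<in> {b k..2 * pi} \<Longrightarrow> strand D (C k) (a k * cis t) \<notin> crossings D"
    using crossing_free_arc[OF D C_less[unfolded n_def] a1 a_nc] unfolding n_def by metis
  define d where "d k = 3 * real k + 3" for k :: nat
  have d1: "d k > 1" for k by (simp add: d_def)
  define L where "L i z = shell_radius (d (pos i)) (fold_angle (b (pos i)) (Arg2pi (z / a (pos i)))) *\<^sub>R strand D i z" for i z
  have norm_L: "norm (L i z) = shell_radius (d (pos i)) (fold_angle (b (pos i)) (Arg2pi (z / a (pos i))))"
    if "i < n" "norm z = 1" for i z
    using norm_strand[OF D] that shell_radius_bounds(3)[OF d1] by (simp add: L_def n_def less_imp_le)
  have angle: "z = a k * cis (Arg2pi (z / a k))" if "k < n" "norm z = 1" for k z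
    using a1[OF that(1)] that(2) by (subst cis_Arg2pi_unit) (auto simp: norm_divide)
  have height: "norm (L j w) < norm (L i z)"
    if p: "p \<in> crossings D" and iz: "(i, z) \<in> preim D p" "(i, z) \<in> overs D"
      and jw: "(j, w) \<in> preim D p" "(j, w) \<notin> overs D" for p i z j w
  proof (cases "i = j")
    case False
    have ij: "i < n" "j < n" "norm z = 1" "norm w = 1"
      using iz jw by (auto simp: mem_preim n_def)
    have "\<not> pos i < pos j"
    proof
      assume lt: "pos i < pos j"
      have "p \<in> warping_between D (C (pos j)) (C (pos i))"
        unfolding warping_between_def using p iz jw C_pos ij by auto
      then have "p \<in> warping_crossings D as"
        unfolding warping_crossings_def C_def using lt pos_less[OF ij(1)] pos_less[OF ij(2)] len
        by (intro UnI2 UN_I[of "n - 1 - pos i"] UN_I[of "n - 1 - pos j"]) auto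
      then show False using no_warp by simp
    qed
    moreover have "pos i \<noteq> pos j" using False C_pos ij by metis
    ultimately have "d (pos j) + 3 \<le> d (pos i)" by (simp add: d_def)
    then have "shell_radius (d (pos j)) t < shell_radius (d (pos i)) s" for s t
      using shell_radius_bounds(2)[OF d1, of "pos j" t] shell_radius_bounds(1)[OF d1, of "pos i" s] by linarith
    then show ?thesis
      unfolding norm_L[OF ij(1,3)] norm_L[OF ij(2,4)] .
  next
    case True
    define k where "k = pos i"
    have i: "i < n" and zw: "norm z = 1" "norm w = 1" "strand D i z = p" "strand D i w = p"
      using iz jw True by (auto simp: mem_preim n_def)
    have k: "k < n" and Ck: "C k = i" using pos_less[OF i] C_pos[OF i] by (auto simp: k_def)
    let ?s = "Arg2pi (z / a k)" and ?t = "Arg2pi (w / a k)"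
    have "preim D p = {(i, z), (i, w)}"
      using crossing_places[OF D p] iz jw True by (smt (verit, best) insertE insert_commute singletonD)
    then have self: "p \<in> self_crossings D i"
      using p by (simp add: self_crossings_def)
    have "\<not> ?t < ?s"
    proof
      assume "?t < ?s"
      then have "p \<in> warping_self D (C k, a k)"
        unfolding warping_self_def using self iz jw True Ck by auto
      then have "p \<in> warping_crossings D as"
        unfolding warping_crossings_def C_def a_def using k len
        by (intro UnI1 UN_I[of "n - 1 - k"]) auto
      then show False using no_warp by simp
    qed
    moreover have "?s \<noteq> ?t"
      using angle[OF k zw(1)] angle[OF k zw(2)] iz(2) jw(2) True by metis
    ultimately have st: "?s < ?t" by simp
    have tb: "?t < b k"
    proof (rule ccontr)
      assume "\<not> ?t < b k"
      then have "strand D (C k) (a k * cis ?t) \<notin> crossings D"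
        using free[OF k, of ?t] Arg2pi[of "w / a k"] by auto
      then show False using angle[OF k zw(2)] zw(4) p Ck by simp
    qed
    have "shell_radius (d k) (fold_angle (b k) ?t) < shell_radius (d k) (fold_angle (b k) ?s)"
    proof (rule shell_radius_strict_antimono[OF d1])
      show "0 \<le> fold_angle (b k) ?s" "fold_angle (b k) ?t \<le> pi"
        using fold_angle_range[OF b[OF k], of ?s] fold_angle_range[OF b[OF k], of ?t]
          Arg2pi[of "z / a k"] Arg2pi[of "w / a k"] by auto
      show "fold_angle (b k) ?s < fold_angle (b k) ?t"
        using st tb b[OF k] by (simp add: fold_angle_down divide_strict_right_mono)
    qed
    then show ?thesis
      using norm_L[OF i zw(1)] norm_L[OF i zw(2)] True by (simp add: k_def)
  qed
  have cont_L: "continuous_on (sphere 0 1) (L i)" if i: "i < n" for i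
    unfolding L_def
  proof (intro continuous_on_scaleR)
    let ?k = "pos i"
    have k: "?k < n" using pos_less[OF i] .
    have "continuous_on {0..2 * pi} (\<lambda>t. shell_radius (d ?k) (fold_angle (b ?k) t))"
      unfolding shell_radius_def by (intro continuous_intros continuous_on_fold_angle b k)
    moreover have "fold_angle (b ?k) 0 = fold_angle (b ?k) (2 * pi)"
      using b[OF k] fold_angle_down[of "b ?k" 0] fold_angle_up[of "b ?k" "2 * pi"] by simp
    ultimately show "continuous_on (sphere 0 1) (\<lambda>z. shell_radius (d ?k) (fold_angle (b ?k) (Arg2pi (z / a ?k))))"
      using a1[OF k] by (intro continuous_on_circle_by_angle) auto
  qed (use continuous_on_strand[OF D] i in \<open>simp add: n_def\<close>)
  have L_ray: "L i z \<noteq> 0" "sgn (L i z) = strand D i z" if "i < n" "norm z = 1" for i z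
  proof -
    have unit: "norm (strand D i z) = 1"
      using norm_strand[OF D] that by (simp add: n_def)
    show "L i z \<noteq> 0"
      using norm_L[OF that] shell_radius_bounds(3)[OF d1] by (metis norm_zero less_irrefl)
    show "sgn (L i z) = strand D i z"
      unfolding L_def sgn_scaleR_pos[OF shell_radius_bounds(3)[OF d1]] using unit by (simp add: sgn_div_norm)
  qed
  have "is_link n L"
    unfolding is_link_def
  proof (intro conjI allI impI cont_L)
    show "inj_on (\<lambda>(i, z). L i z) (places n)"
    proof (rule inj_onI, clarify, rule ccontr)
      fix i z j w
      assume pl: "(i, z) \<in> places n" "(j, w) \<in> places n" and eq: "L i z = L j w" and ne: "\<not> (i = j \<and> z = w)"
      then have ij: "i < n" "norm z = 1" "j < n" "norm w = 1" by (auto simp: places_def dist_norm)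
      then have st: "strand D i z = strand D j w" using L_ray(2) eq by metis
      define p where "p = strand D i z"
      have p: "p \<in> crossings D"
        unfolding p_def using coincident_places_cross[of i z D j w] pl ne st by (auto simp: n_def)
      have mem: "(i, z) \<in> preim D p" "(j, w) \<in> preim D p"
        using ij st by (auto simp: mem_preim p_def n_def)
      obtain x y where xy: "preim D p = {x, y}" "x \<noteq> y" "x \<in> overs D" "y \<notin> overs D"
        using crossing_places[OF D p] .
      then consider "(i, z) = x" "(j, w) = y" | "(i, z) = y" "(j, w) = x"
        using mem ne by auto
      then show False
        using height[OF p] mem xy eq by (metis less_irrefl)
    qed
  qed
  then have diagram: "has_diagram L D"
    unfolding has_diagram_def using L_ray height
    by (auto simp: n_def[symmetric] places_def dist_norm)
  define P where "P k t = strand D (C k) (a k * cis (b k * t / pi))" for k t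
  define Q where "Q k t = strand D (C k) (a k * cis (2 * pi - (2 * pi - b k) * t / pi))" for k t
  have strands: "\<exists>W. continuous_on {0..pi} (P k) \<and> continuous_on {0..pi} (Q k) \<and> continuous_on {0..pi} W \<and>
    (\<forall>t\<in>{0..pi}. Q k t - P k t = sin t *\<^sub>R W t) \<and>
    (\<forall>t\<in>{0..pi}. W t \<noteq> 0) \<and> W 0 \<bullet> P k 0 = 0 \<and> W pi \<bullet> P k pi = 0" if k: "k < n" for k
  proof -
    let ?g = "\<lambda>t. strand D (C k) (a k * cis t)" and ?g' = "\<lambda>t. velocity D (C k, a k * cis t)"
    have Ck: "C k < ncomp D" using C_less[OF k] by (simp add: n_def)
    have unit: "norm (a k * cis t) = 1" for t using a1[OF k] by (simp add: norm_mult)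
    have periodic: "?g (t - 2 * pi) = ?g t" for t
      by (simp add: cis_divide[symmetric] cis_2pi)
    have v: "?g' t \<noteq> 0" for t
      using D Ck unit[of t] by (auto simp: link_diagram_def places_def dist_norm)
    have ne: "?g (b k * t / pi) \<noteq> ?g (2 * pi - (2 * pi - b k) * t / pi)" if t: "0 < t" "t < pi" for t
    proof
      let ?u = "b k * t / pi" and ?v = "2 * pi - (2 * pi - b k) * t / pi"
      assume eq: "?g ?u = ?g ?v"
      have u: "0 \<le> ?u" "?u < b k" using t b[OF k] by (auto simp: divide_less_eq)
      have "(2 * pi - b k) * t / pi < 2 * pi - b k" "0 < (2 * pi - b k) * t / pi"
        using t b[OF k] by (auto simp: divide_less_eq)
      then have v: "b k < ?v" "?v < 2 * pi" by auto
      have "cis ?u \<noteq> cis ?v"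
        using Arg2pi_cis[of ?u] Arg2pi_cis[of ?v] u v b[OF k] by (metis less_le_trans less_trans less_asym less_imp_le order.strict_trans1)
      then have "(C k, a k * cis ?v) \<noteq> (C k, a k * cis ?u)" using a1[OF k] by auto
      then have "?g ?v \<in> crossings D"
        using coincident_places_cross[of "C k" "a k * cis ?v" D "C k" "a k * cis ?u"] eq Ck unit
        by (auto simp: places_def dist_norm)
      then show False using free[OF k, of ?v] v by auto
    qed
    obtain W where "continuous_on {0..pi} (P k)" "continuous_on {0..pi} (Q k)" "continuous_on {0..pi} W"
      "\<And>t. t \<in> {0..pi} \<Longrightarrow> Q k t - P k t = sin t *\<^sub>R W t"
      "\<And>t. t \<in> {0..pi} \<Longrightarrow> W t \<noteq> 0" "W 0 \<bullet> P k 0 = 0" "W pi \<bullet> P k pi = 0"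
      using loop_in_two_strands[of ?g ?g' "b k", OF periodic strand_has_velocity[OF D Ck a1[OF k]] v
          norm_strand[OF D Ck unit] b[OF k] ne]
      unfolding P_def Q_def by blast
    then show ?thesis by blast
  qed
  then obtain W where W: "\<And>k. k < n \<Longrightarrow> continuous_on {0..pi} (P k) \<and> continuous_on {0..pi} (Q k) \<and> continuous_on {0..pi} (W k) \<and>
    (\<forall>t\<in>{0..pi}. Q k t - P k t = sin t *\<^sub>R W k t) \<and>
    (\<forall>t\<in>{0..pi}. W k t \<noteq> 0) \<and> W k 0 \<bullet> P k 0 = 0 \<and> W k pi \<bullet> P k pi = 0"
    by metis
  have "(\<lambda>t. strand D i (cis t)) differentiable (at t)" if "i < n" for i t
    using strand_has_velocity[OF D, of i 1] that by (auto simp: n_def intro: differentiableI_vector)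
  then obtain N where N: "norm N = 1" "N $ 1 < 0" and off: "\<And>i t. i < n \<Longrightarrow> strand D i (cis t) \<noteq> N"
    using exists_unit_vector_off_curves[of n "\<lambda>i t. strand D i (cis t)"] by blast
  have off': "strand D i z \<noteq> N" if "i < n" "norm z = 1" for i z
    using off[OF that(1), of "Arg2pi z"] cis_Arg2pi_unit[OF that(2)] by simp
  have unit: "norm (a k * cis t) = 1" if "k < n" for k t using a1[OF that] by (simp add: norm_mult)
  have unlink: "ambient_isotopic
    (\<Union>k<n. \<Union>t\<in>{0..pi}. {shell_radius (3 * real k + 3) t *\<^sub>R P k t, shell_radius (3 * real k + 3) t *\<^sub>R Q k t}) (standard_unlink n)"
    (is "ambient_isotopic ?S _")
  proof (rule two_strand_link_is_unlink[where W = W and N = N])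
    fix k t assume k: "k < n"
    show "norm (P k t) = 1" "norm (Q k t) = 1"
      using norm_strand[OF D] C_less[OF k] unit[OF k] by (simp_all add: P_def Q_def n_def)
    show "P k t \<noteq> N" "Q k t \<noteq> N"
      using off'[OF C_less[OF k]] unit[OF k] by (simp_all add: P_def Q_def)
  qed (use W N in blast)+
  have "link_image n L = ?S"
  proof (intro equalityI subsetI)
    fix x assume "x \<in> link_image n L"
    then obtain i z where i: "i < n" "norm z = 1" and x: "x = L i z"
      by (auto simp: link_image_def dist_norm)
    define k where "k = pos i"
    have k: "k < n" "C k = i" using pos_less C_pos i by (auto simp: k_def)
    let ?s = "Arg2pi (z / a k)"
    define t where "t = fold_angle (b k) ?s"
    have s: "0 \<le> ?s" "?s < 2 * pi" using Arg2pi[of "z / a k"] by auto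
    have t: "t \<in> {0..pi}" unfolding t_def using fold_angle_range[OF b[OF k(1)]] s by auto
    have xt: "x = shell_radius (3 * real k + 3) t *\<^sub>R strand D i (a k * cis ?s)"
      using angle[OF k(1) i(2)] by (simp add: x L_def k_def[symmetric] t_def d_def)
    have "strand D i (a k * cis ?s) = P k t \<or> strand D i (a k * cis ?s) = Q k t"
    proof (cases "?s \<le> b k")
      case True
      then have "b k * t / pi = ?s" using b[OF k(1)] by (simp add: t_def fold_angle_down)
      then show ?thesis by (simp add: P_def k)
    next
      case False
      then have "2 * pi - (2 * pi - b k) * t / pi = ?s" using b[OF k(1)] by (simp add: t_def fold_angle_up)
      then show ?thesis by (simp add: Q_def k)
    qed
    then have "x \<in> {shell_radius (3 * real k + 3) t *\<^sub>R P k t, shell_radius (3 * real k + 3) t *\<^sub>R Q k t}"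
      unfolding xt by (elim disjE) simp_all
    with t k(1) show "x \<in> ?S"
      by (intro UN_I[of k] UN_I[of t]) (rule lessThan_iff[THEN iffD2])
  next
    fix x assume "x \<in> ?S"
    then obtain k t where k: "k < n" and t: "t \<in> {0..pi}"
      and x: "x = shell_radius (d k) t *\<^sub>R P k t \<or> x = shell_radius (d k) t *\<^sub>R Q k t"
      by (auto simp: d_def)
    have a0: "a k \<noteq> 0" using a1[OF k] by auto
    have L_angle: "L (C k) (a k * cis s) = shell_radius (d k) (fold_angle (b k) s) *\<^sub>R strand D (C k) (a k * cis s)"
      if "0 \<le> s" "s \<le> 2 * pi" for s
    proof (cases "s = 2 * pi")
      case True
      then show ?thesis
        using a0 b[OF k] fold_angle_down[of "b k" 0] fold_angle_up[of "b k" "2 * pi"]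
        by (simp add: L_def pos_C[OF k] cis_2pi Arg2pi_cis[of 0, simplified])
    next
      case False
      then show ?thesis using a0 that by (simp add: L_def pos_C[OF k] Arg2pi_cis)
    qed
    have L_mem: "L (C k) (a k * cis s) \<in> link_image n L" for s
      unfolding link_image_def using C_less[OF k] unit[OF k, of s]
      by (intro UN_I[of "C k"] imageI) (simp_all add: dist_norm)
    have bt: "0 \<le> b k * t / pi" "b k * t / pi \<le> b k"
      using t b[OF k] by (auto simp: divide_le_eq)
    have "(2 * pi - b k) * t / pi \<le> 2 * pi - b k" "0 \<le> (2 * pi - b k) * t / pi"
      using t b[OF k] by (auto simp: divide_le_eq)
    then have ct: "b k \<le> 2 * pi - (2 * pi - b k) * t / pi" "2 * pi - (2 * pi - b k) * t / pi \<le> 2 * pi" by auto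
    have "fold_angle (b k) (b k * t / pi) = t"
      using bt b[OF k] by (subst fold_angle_down) auto
    then have "shell_radius (d k) t *\<^sub>R P k t = L (C k) (a k * cis (b k * t / pi))"
      using L_angle bt b[OF k] by (simp add: P_def)
    moreover have "fold_angle (b k) (2 * pi - (2 * pi - b k) * t / pi) = t"
      using ct b[OF k] by (subst fold_angle_up) auto
    then have "shell_radius (d k) t *\<^sub>R Q k t = L (C k) (a k * cis (2 * pi - (2 * pi - b k) * t / pi))"
      using L_angle ct b[OF k] by (simp add: Q_def)
    ultimately show "x \<in> link_image n L" using x L_mem by metis
  qed
  then have "trivial_link n L"
    unfolding trivial_link_def using \<open>is_link n L\<close> unlink by simp
  then show ?thesis
    unfolding trivial_diagram_def using diagram by (auto simp: n_def)
qed

section \<open>Changing the warping crossings\<close>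

definition change_all :: "(real^3) set \<Rightarrow> diagram \<Rightarrow> diagram" where
  "change_all S D = D\<lparr>overs := (overs D - (\<Union>p\<in>S. preim D p)) \<union> ((\<Union>p\<in>S. preim D p) - overs D)\<rparr>"

lemma change_all_simps [simp]:
  "ncomp (change_all S D) = ncomp D" "strand (change_all S D) = strand D"
  "preim (change_all S D) = preim D" "crossings (change_all S D) = crossings D"
  "velocity (change_all S D) = velocity D" "base_point_seq (change_all S D) as = base_point_seq D as"
  by (simp_all add: change_all_def preim_def crossings_def velocity_def base_point_seq_def fun_eq_iff)

lemma overs_change_all:
  assumes "x \<in> preim D p"
  shows "x \<in> overs (change_all S D) \<longleftrightarrow> (x \<in> overs D) \<noteq> (p \<in> S)"
  using assms by (auto simp: change_all_def preim_def)

lemma overs_change_all_outside: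
  assumes "x \<in> overs (change_all S D)" "x \<notin> overs D"
  shows "x \<in> (\<Union>p\<in>S. preim D p)"
  using assms by (auto simp: change_all_def)

lemma crossing_changes_change_all:
  assumes "finite S" "S \<subseteq> crossings D"
  shows "(crossing_change ^^ card S) D (change_all S D)"
  using assms
proof (induction S rule: finite_induct)
  case empty
  show ?case by (simp add: change_all_def)
next
  case (insert p S)
  have symm_diff: "(X - (B \<union> A)) \<union> ((B \<union> A) - X) = (((X - A) \<union> (A - X)) - B) \<union> (B - ((X - A) \<union> (A - X)))"
    if "B \<inter> A = {}" for X A B :: "(nat \<times> complex) set"
    using that by blast
  have "preim D p \<inter> (\<Union>q\<in>S. preim D q) = {}"
    using insert.hyps(2) by (auto simp: preim_def)
  from symm_diff[OF this, of "overs D"]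
  have "overs (change_all (insert p S) D) =
      (overs (change_all S D) - preim D p) \<union> (preim D p - overs (change_all S D))"
    unfolding change_all_def by simp
  then have "change_all (insert p S) D = change_at p (change_all S D)"
    unfolding change_at_def change_all_simps by (simp add: change_all_def)
  then have "crossing_change (change_all S D) (change_all (insert p S) D)"
    using insert.prems by (auto simp: crossing_change_def)
  moreover have "(crossing_change ^^ card S) D (change_all S D)"
    using insert by simp
  ultimately show ?case
    using insert.hyps by (auto simp: relcompp_apply)
qed

lemma link_diagram_change_all:
  assumes D: "link_diagram D" and S: "S \<subseteq> crossings D"
  shows "link_diagram (change_all S D)"
proof -
  have "\<exists>!x. x \<in> preim D p \<inter> overs (change_all S D)" if p: "p \<in> crossings D" for p
  proof -
    obtain x y where xy: "preim D p = {x, y}" "x \<noteq> y" "x \<in> overs D" "y \<notin> overs D"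
      using crossing_places[OF D p] .
    then have "x \<in> overs (change_all S D) \<longleftrightarrow> p \<notin> S" "y \<in> overs (change_all S D) \<longleftrightarrow> p \<in> S"
      using overs_change_all[of _ D p S] by auto
    then show ?thesis using xy by (cases "p \<in> S") auto
  qed
  moreover have "overs (change_all S D) \<subseteq> (\<Union>p\<in>crossings D. preim D p)"
  proof
    fix x assume x: "x \<in> overs (change_all S D)"
    have "overs D \<subseteq> (\<Union>p\<in>crossings D. preim D p)" using D by (simp add: link_diagram_def)
    moreover have "x \<in> overs D \<or> x \<in> (\<Union>p\<in>S. preim D p)"
      using overs_change_all_outside[OF x] by blast
    ultimately show "x \<in> (\<Union>p\<in>crossings D. preim D p)" using S by blast
  qed
  ultimately show ?thesis
    using D by (simp add: link_diagram_def)
qed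

text \<open>
  The condition for a crossing with over-place \<open>x\<close> and under-place \<open>y\<close> to be warping: travelling
  along the components in their order, one meets \<open>y\<close> before \<open>x\<close>. A crossing change swaps the roles
  of \<open>x\<close> and \<open>y\<close>, and the relation is asymmetric when each component is listed once.
\<close>

definition under_first :: "(nat \<times> complex) list \<Rightarrow> nat \<times> complex \<Rightarrow> nat \<times> complex \<Rightarrow> bool" where
  "under_first as x y \<longleftrightarrow>
     (\<exists>k<length as. fst (as ! k) = fst x \<and> fst (as ! k) = fst y \<and>
        Arg2pi (snd y / snd (as ! k)) < Arg2pi (snd x / snd (as ! k))) \<or>
     (\<exists>l<length as. \<exists>k<l. fst (as ! k) = fst y \<and> fst (as ! l) = fst x)"

lemma warping_crossings_iff:
  assumes "p \<in> crossings D" and pre: "preim D p = {x, y}" "x \<in> overs D" "y \<notin> overs D"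
  shows "p \<in> warping_crossings D as \<longleftrightarrow> under_first as x y"
proof -
  obtain i z j w where xy: "x = (i, z)" "y = (j, w)" by fastforce
  have over: "(i', z') \<in> preim D p \<inter> overs D \<longleftrightarrow> i' = i \<and> z' = z"
    and under: "(i', z') \<in> preim D p - overs D \<longleftrightarrow> i' = j \<and> z' = w" for i' z'
    using pre xy by auto
  have "p \<in> self_crossings D m \<longleftrightarrow> m = i \<and> m = j" for m
    using assms(1) pre xy by (auto simp: self_crossings_def)
  then have "p \<in> warping_self D (m, a) \<longleftrightarrow> m = i \<and> m = j \<and> Arg2pi (w / a) < Arg2pi (z / a)" for m a
    unfolding warping_self_def prod.case mem_Collect_eq over under by auto
  then have "p \<in> warping_self D u \<longleftrightarrow> fst u = i \<and> fst u = j \<and> Arg2pi (w / snd u) < Arg2pi (z / snd u)" for u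
    by (cases u) simp
  moreover have "p \<in> warping_between D m m' \<longleftrightarrow> m = j \<and> m' = i" for m m'
    unfolding warping_between_def mem_Collect_eq over under using assms(1) by auto
  ultimately show ?thesis
    unfolding warping_crossings_def under_first_def xy by auto
qed

lemma under_first_asym:
  assumes dist: "distinct (map fst as)" and "under_first as x y"
  shows "\<not> under_first as y x"
proof -
  have "k = l" if "k < length as" "l < length as" "fst (as ! k) = fst (as ! l)" for k l
    using nth_eq_iff_index_eq[OF dist, of k l] that by simp
  then show ?thesis
    using assms(2) unfolding under_first_def by (smt (verit) less_trans less_asym less_irrefl)
qed

lemma warping_crossings_subset: "warping_crossings D as \<subseteq> crossings D"
  by (auto simp: warping_crossings_def warping_self_def warping_between_def self_crossings_def)

lemma no_warping_after_changes:
  assumes D: "link_diagram D" and as: "base_point_seq D as"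
  shows "warping_crossings (change_all (warping_crossings D as) D) as = {}"
proof (rule ccontr)
  let ?W = "warping_crossings D as" and ?E = "change_all (warping_crossings D as) D"
  have dist: "distinct (map fst as)" using as by (simp add: base_point_seq_def)
  assume "warping_crossings ?E as \<noteq> {}"
  then obtain p where pE: "p \<in> warping_crossings ?E as" by blast
  then have p: "p \<in> crossings D" using warping_crossings_subset[of ?E as] by auto
  obtain x y where xy: "preim D p = {x, y}" "x \<in> overs D" "y \<notin> overs D"
    using crossing_places[OF D p] by metis
  have iff: "p \<in> ?W \<longleftrightarrow> under_first as x y"
    by (rule warping_crossings_iff[OF p xy])
  have overs: "x \<in> overs ?E \<longleftrightarrow> p \<notin> ?W" "y \<in> overs ?E \<longleftrightarrow> p \<in> ?W"
    using overs_change_all[of _ D p ?W] xy by auto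
  show False
  proof (cases "p \<in> ?W")
    case True
    have "under_first as y x"
      using warping_crossings_iff[of p ?E y x as] pE p xy overs True by (simp add: insert_commute)
    then show False using under_first_asym[OF dist] iff True by blast
  next
    case False
    have "under_first as x y"
      using warping_crossings_iff[of p ?E x y as] pE p xy overs False by simp
    then show False using iff False by blast
  qed
qed

lemma exists_base_point_seq:
  assumes D: "link_diagram D"
  shows "\<exists>as. base_point_seq D as"
proof -
  have "\<exists>a. norm a = 1 \<and> strand D i a \<notin> crossings D" if i: "i < ncomp D" for i
  proof -
    have "infinite (sphere (0 :: complex) 1)"
    proof
      assume "finite (sphere (0 :: complex) 1)"
      then have "finite (Arg2pi ` sphere 0 1)" by blast
      moreover have "{0..<2 * pi} \<subseteq> Arg2pi ` sphere 0 1"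
      proof
        fix t :: real assume "t \<in> {0..<2 * pi}"
        then show "t \<in> Arg2pi ` sphere 0 1"
          by (intro image_eqI[of _ Arg2pi "cis t"]) (auto simp: Arg2pi_cis dist_norm)
      qed
      ultimately have "finite {0..<2 * pi}" by (rule rev_finite_subset)
      then show False by (simp add: infinite_Ico)
    qed
    moreover have "finite (snd ` (\<Union>p\<in>crossings D. preim D p))"
      using finite_crossing_places[OF D] by simp
    ultimately obtain a where a: "a \<in> sphere 0 1" "a \<notin> snd ` (\<Union>p\<in>crossings D. preim D p)"
      by (meson finite_subset subsetI)
    have "strand D i a \<notin> crossings D"
    proof
      assume "strand D i a \<in> crossings D"
      moreover have "(i, a) \<in> preim D (strand D i a)" using i a(1) by (simp add: mem_preim dist_norm)
      ultimately show False using a(2) by force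
    qed
    then show ?thesis using a(1) by (auto simp: dist_norm)
  qed
  then obtain a where "\<And>i. i < ncomp D \<Longrightarrow> norm (a i) = 1 \<and> strand D i (a i) \<notin> crossings D"
    by metis
  then have "base_point_seq D (map (\<lambda>i. (i, a i)) [0..<ncomp D])"
    by (auto simp: base_point_seq_def o_def dist_norm)
  then show ?thesis by blast
qed

lemma unlinking_number_le_warping_degree:
  assumes D: "link_diagram D"
  shows "unlinking_number D \<le> warping_degree D"
proof -
  have "\<exists>n as. base_point_seq D as \<and> warping_degree_at D as = n"
    using exists_base_point_seq[OF D] by blast
  then have "\<exists>as. base_point_seq D as \<and> warping_degree_at D as = warping_degree D"
    unfolding warping_degree_def by (rule LeastI_ex)
  then obtain as where as: "base_point_seq D as" "warping_degree_at D as = warping_degree D"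
    by blast
  let ?W = "warping_crossings D as"
  have "finite ?W"
    using D warping_crossings_subset[of D as] by (auto simp: link_diagram_def intro: finite_subset)
  then have "(crossing_change ^^ card ?W) D (change_all ?W D)"
    using warping_crossings_subset by (rule crossing_changes_change_all)
  moreover have "trivial_diagram (change_all ?W D)"
    using link_diagram_change_all[OF D warping_crossings_subset] no_warping_after_changes[OF D as(1)] as(1)
    by (intro trivial_if_no_warping_crossings[where as = as]) simp_all
  ultimately have "unlinking_number D \<le> card ?W"
    unfolding unlinking_number_def by (intro Least_le) blast
  then show ?thesis
    using as(2) by (simp add: warping_degree_at_def)
qed

section \<open>Reversing the orientation\<close>

lemma reverse_diagram_simps [simp]:
  "ncomp (reverse_diagram D) = ncomp D" "strand (reverse_diagram D) i z = strand D i (cnj z)"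
  "(i, z) \<in> overs (reverse_diagram D) \<longleftrightarrow> (i, cnj z) \<in> overs D"
  by (simp_all add: reverse_diagram_def)

lemma reverse_reverse_diagram [simp]: "reverse_diagram (reverse_diagram D) = D"
  by (cases D) (simp add: reverse_diagram_def)

definition reverse_place :: "nat \<times> complex \<Rightarrow> nat \<times> complex" where
  "reverse_place x = (fst x, cnj (snd x))"

lemma reverse_place_involution [simp]: "reverse_place (reverse_place x) = x"
  by (simp add: reverse_place_def)

lemma inj_reverse_place: "inj reverse_place"
  by (metis injI reverse_place_involution)

lemma mem_reverse_place_image: "x \<in> reverse_place ` A \<longleftrightarrow> reverse_place x \<in> A"
  by (metis image_eqI imageE reverse_place_involution)

lemma overs_reverse_diagram: "overs (reverse_diagram D) = reverse_place ` overs D"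
proof (rule set_eqI)
  show "x \<in> overs (reverse_diagram D) \<longleftrightarrow> x \<in> reverse_place ` overs D" for x
    unfolding mem_reverse_place_image by (cases x) (simp add: reverse_place_def)
qed

lemma preim_reverse_diagram: "preim (reverse_diagram D) p = reverse_place ` preim D p"
proof (rule set_eqI)
  show "x \<in> preim (reverse_diagram D) p \<longleftrightarrow> x \<in> reverse_place ` preim D p" for x
    unfolding mem_reverse_place_image by (cases x) (simp add: reverse_place_def mem_preim)
qed

lemma crossings_reverse_diagram [simp]: "crossings (reverse_diagram D) = crossings D"
  unfolding crossings_def preim_reverse_diagram by (simp add: inj_eq[OF inj_reverse_place])

lemma velocity_reverse_diagram:
  assumes D: "link_diagram D" and x: "x \<in> places (ncomp D)"
  shows "velocity (reverse_diagram D) (reverse_place x) = - velocity D x"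
proof -
  obtain i z where iz: "x = (i, z)" "i < ncomp D" "norm z = 1"
    using x by (auto simp: places_def dist_norm)
  have "((\<lambda>t. strand D i (z * cis t)) has_vector_derivative velocity D x) (at (- 0))"
    using strand_has_velocity[OF D iz(2,3), of 0] iz(1) by simp
  moreover have "((\<lambda>t. - t) has_vector_derivative - 1) (at (0 :: real))"
    by (auto intro!: derivative_eq_intros)
  ultimately have "((\<lambda>t. strand D i (z * cis (- t))) has_vector_derivative - velocity D x) (at 0)"
    using vector_diff_chain_at[of uminus "-1" 0 "\<lambda>t. strand D i (z * cis t)"] by (simp add: o_def)
  then show ?thesis
    by (simp add: velocity_def iz(1) reverse_place_def cis_cnj vector_derivative_at)
qed

lemma link_diagram_reverse:
  assumes D: "link_diagram D"
  shows "link_diagram (reverse_diagram D)"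
proof -
  let ?R = "reverse_diagram D"
  have place: "reverse_place x \<in> places n \<longleftrightarrow> x \<in> places n" for x n
    by (cases x) (simp add: reverse_place_def places_def dist_norm)
  have sub: "preim D p \<subseteq> places (ncomp D)" for p by (auto simp: preim_def)
  have "strand ?R i ` sphere 0 1 \<subseteq> sphere 0 1" if "i < ncomp D" for i
    using norm_strand[OF D that] by (auto simp: dist_norm)
  moreover have "(\<lambda>t. strand ?R i (cis t)) C1_differentiable_on UNIV" if i: "i < ncomp D" for i
  proof -
    have "((\<lambda>t. strand D i (cis t)) \<circ> uminus) C1_differentiable_on UNIV"
    proof (rule C1_differentiable_compose)
      show "(uminus :: real \<Rightarrow> real) C1_differentiable_on UNIV"
        by simp
      show "(\<lambda>t. strand D i (cis t)) C1_differentiable_on uminus ` UNIV"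
        using D i by (auto simp: link_diagram_def)
      show "finite (UNIV \<inter> uminus -` {x})" for x :: real
        by (rule finite_subset[of _ "{- x}"]) auto
    qed
    then show ?thesis by (simp add: o_def cis_cnj)
  qed
  moreover have "velocity ?R x \<noteq> 0" if "x \<in> places (ncomp D)" for x
    using velocity_reverse_diagram[OF D, of "reverse_place x"] that D place[of x]
    by (auto simp: link_diagram_def)
  moreover have "card (preim ?R p) = 2" if "p \<in> crossings D" for p
    using that D card_image[OF inj_on_subset[OF inj_reverse_place]]
    by (simp add: preim_reverse_diagram link_diagram_def)
  moreover have "\<not> collinear {0, velocity ?R x, velocity ?R y}"
    if p: "p \<in> crossings D" and xy: "x \<in> preim ?R p" "y \<in> preim ?R p" "x \<noteq> y" for p x y
  proof -
    obtain u v where uv: "x = reverse_place u" "y = reverse_place v" "u \<in> preim D p" "v \<in> preim D p" "u \<noteq> v"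
      using xy by (auto simp: preim_reverse_diagram)
    then have "\<not> collinear {0, velocity D u, velocity D v}"
      using D p by (simp add: link_diagram_def)
    moreover have "velocity ?R x = - velocity D u" "velocity ?R y = - velocity D v"
      using velocity_reverse_diagram[OF D subsetD[OF sub]] uv by auto
    ultimately show ?thesis
      by (simp add: collinear_lemma)
  qed
  moreover have "\<exists>!x. x \<in> preim ?R p \<inter> overs ?R" if p: "p \<in> crossings D" for p
  proof -
    have "preim ?R p \<inter> overs ?R = reverse_place ` (preim D p \<inter> overs D)"
      unfolding preim_reverse_diagram overs_reverse_diagram
      using image_Int[OF inj_reverse_place] by metis
    moreover obtain x where "preim D p \<inter> overs D = {x}"
      using D p unfolding link_diagram_def by (metis (no_types, lifting) is_singletonI' is_singletonE empty_iff)
    ultimately show ?thesis by auto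
  qed
  moreover have "overs ?R \<subseteq> (\<Union>p\<in>crossings D. preim ?R p)"
  proof -
    have "overs D \<subseteq> (\<Union>p\<in>crossings D. preim D p)" using D by (simp add: link_diagram_def)
    then show ?thesis unfolding overs_reverse_diagram preim_reverse_diagram by blast
  qed
  ultimately show ?thesis
    using D unfolding link_diagram_def by simp
qed

lemma trivial_diagram_reverse:
  assumes "trivial_diagram D"
  shows "trivial_diagram (reverse_diagram D)"
proof -
  obtain L where L: "has_diagram L D" and triv: "trivial_link (ncomp D) L"
    using assms by (auto simp: trivial_diagram_def)
  define L' where "L' i z = L i (cnj z)" for i z
  have link: "is_link (ncomp D) L" using L by (simp add: has_diagram_def)
  have cnj_img: "cnj ` sphere 0 1 = sphere 0 1"
  proof
    show "sphere 0 1 \<subseteq> cnj ` sphere 0 1"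
      by (intro subsetI image_eqI[of _ cnj "cnj _"]) (auto simp: dist_norm)
  qed (auto simp: dist_norm)
  have "is_link (ncomp D) L'"
    unfolding is_link_def
  proof (intro conjI allI impI)
    fix i assume "i < ncomp D"
    then have "continuous_on (sphere 0 1) (L i)" using link by (simp add: is_link_def)
    then show "continuous_on (sphere 0 1) (L' i)"
      unfolding L'_def by (rule continuous_on_compose2) (use cnj_img in \<open>auto intro!: continuous_intros\<close>)
  next
    have inj: "inj_on (\<lambda>(i, z). L i z) (places (ncomp D))" using link by (simp add: is_link_def)
    show "inj_on (\<lambda>(i, z). L' i z) (places (ncomp D))"
    proof (rule inj_onI, clarify)
      fix i z j w
      assume "(i, z) \<in> places (ncomp D)" "(j, w) \<in> places (ncomp D)" "L' i z = L' j w"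
      then have "(i, cnj z) = (j, cnj w)"
        using inj_onD[OF inj, of "(i, cnj z)" "(j, cnj w)"] by (simp add: L'_def places_def dist_norm)
      then show "i = j \<and> z = w" by simp
    qed
  qed
  moreover have "link_image (ncomp D) L' = link_image (ncomp D) L"
    unfolding link_image_def L'_def using cnj_img by (metis (no_types) image_image)
  moreover have "has_diagram L' (reverse_diagram D)"
    unfolding has_diagram_def
  proof (intro conjI ballI)
    show "is_link (ncomp (reverse_diagram D)) L'" using \<open>is_link (ncomp D) L'\<close> by simp
    have ray: "\<And>i z. i < ncomp D \<Longrightarrow> norm z = 1 \<Longrightarrow> L i z \<noteq> 0 \<and> sgn (L i z) = strand D i z"
      using L by (auto simp: has_diagram_def places_def dist_norm)
    show "case x of (i, z) \<Rightarrow> L' i z \<noteq> 0 \<and> sgn (L' i z) = strand (reverse_diagram D) i z"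
      if "x \<in> places (ncomp (reverse_diagram D))" for x
      using that ray by (auto simp: L'_def places_def dist_norm)
    have height: "\<And>p i z j w. p \<in> crossings D \<Longrightarrow> (i, z) \<in> preim D p \<Longrightarrow> (i, z) \<in> overs D \<Longrightarrow>
        (j, w) \<in> preim D p \<Longrightarrow> (j, w) \<notin> overs D \<Longrightarrow> norm (L j w) < norm (L i z)"
      using L unfolding has_diagram_def by blast
    fix p x assume p: "p \<in> crossings (reverse_diagram D)"
      and x: "x \<in> preim (reverse_diagram D) p \<inter> overs (reverse_diagram D)"
    show "case x of (i, z) \<Rightarrow> \<forall>(j, w)\<in>preim (reverse_diagram D) p - overs (reverse_diagram D). norm (L' j w) < norm (L' i z)"
      using p x height by (auto simp: L'_def mem_preim)
  qed
  ultimately show ?thesis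
    using triv unfolding trivial_diagram_def trivial_link_def by (intro exI[of _ L']) simp
qed

lemma crossing_change_reverse:
  assumes "crossing_change D E"
  shows "crossing_change (reverse_diagram D) (reverse_diagram E)"
proof -
  obtain p where p: "p \<in> crossings D" "E = change_at p D"
    using assms by (auto simp: crossing_change_def)
  have "overs (reverse_diagram (change_at p D)) = overs (change_at p (reverse_diagram D))"
    unfolding overs_reverse_diagram change_at_def
    by (simp add: overs_reverse_diagram preim_reverse_diagram image_Un image_set_diff[OF inj_reverse_place])
  then have "reverse_diagram (change_at p D) = change_at p (reverse_diagram D)"
    by (simp add: reverse_diagram_def change_at_def)
  then show ?thesis
    using p by (auto simp: crossing_change_def)
qed

lemma crossing_changes_reverse:
  "(crossing_change ^^ n) D E \<Longrightarrow> (crossing_change ^^ n) (reverse_diagram D) (reverse_diagram E)"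
  by (induction n arbitrary: E) (auto intro!: relcomppI crossing_change_reverse)

lemma unlinking_number_reverse: "unlinking_number (reverse_diagram D) = unlinking_number D"
proof -
  have "\<exists>E'. (crossing_change ^^ n) (reverse_diagram D) E' \<and> trivial_diagram E'"
    if "(crossing_change ^^ n) D E" "trivial_diagram E" for n D E
    using crossing_changes_reverse[OF that(1)] trivial_diagram_reverse[OF that(2)] by blast
  from this[of _ D] this[of _ "reverse_diagram D"]
  have "(\<exists>E. (crossing_change ^^ n) (reverse_diagram D) E \<and> trivial_diagram E) \<longleftrightarrow>
      (\<exists>E. (crossing_change ^^ n) D E \<and> trivial_diagram E)" for n
    by fastforce
  then show ?thesis by (simp add: unlinking_number_def)
qed

section \<open>The inequality\<close>

theorem theorem1p4:
  fixes D :: diagram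
  assumes "link_diagram D"
  shows "2 * unlinking_number D + sr D
           \<le> warping_degree D + warping_degree (reverse_diagram D) + sr D"
  using unlinking_number_le_warping_degree[OF assms]
    unlinking_number_le_warping_degree[OF link_diagram_reverse[OF assms]]
  by (simp add: unlinking_number_reverse)

end
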